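(* Let $\rho\in(0,\tfrac12)$. There exists a constant $C>0$ depending only on $\rho$ such that the following holds for every integer $n\ge 1$. Let $M_n=(a_{ij})_{1\le i,j\le n}$ be a random $n\times n$ matrix whose entries $a_{ij}$ are independent (not necessarily identically distributed) real random variables, and assume that for all $i,j=1,\dots,n$ there are real numbers $x_{ij}^-<x_{ij}^+$ with $$\mathbb{P}(a_{ij}>x_{ij}^+)>\rho\quad\text{and}\quad \mathbb{P}(a_{ij}<x_{ij}^-)>\rho .$$ Then $$\mathbb{P}(M_n \text{ is singular})\le \frac{C}{\sqrt n}.$$ *)

theory Defs
  imports "HOL-Probability.Probability" "Jordan_Normal_Form.Matrix"
begin

(* Indices run over 0..<n. *)
definition random_matrix :: "nat \<Rightarrow> (nat \<times> nat \<Rightarrow> 'w \<Rightarrow> real) \<Rightarrow> 'w \<Rightarrow> real mat" where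
  "random_matrix n a \<omega> = Matrix.mat n n (\<lambda>ij. a ij \<omega>)"

definition singular_mat :: "real mat \<Rightarrow> bool" where
  "singular_mat A \<longleftrightarrow> square_mat A \<and> \<not> invertible_mat A"

(* indep_vars includes the measurability of each entry. *)
definition independent_spread_entries ::
    "real \<Rightarrow> nat \<Rightarrow> 'w measure \<Rightarrow> (nat \<times> nat \<Rightarrow> 'w \<Rightarrow> real) \<Rightarrow> bool" where
  "independent_spread_entries \<rho> n M a \<longleftrightarrow>
     prob_space.indep_vars M (\<lambda>_. borel) a ({..<n} \<times> {..<n}) \<and>
     (\<forall>i<n. \<forall>j<n. \<exists>xm xp. xm < xp \<and>
        \<P>(\<omega> in M. a (i, j) \<omega> > xp) > \<rho> \<and> \<P>(\<omega> in M. a (i, j) \<omega> < xm) > \<rho>)"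

(* The constant C serves all sizes n and all probability spaces with sample points in 'w. *)
definition singularity_bound :: "'w itself \<Rightarrow> real \<Rightarrow> real \<Rightarrow> bool" where
  "singularity_bound (_ :: 'w itself) \<rho> C \<longleftrightarrow>
     (\<forall>n\<ge>1. \<forall>(M :: 'w measure) a.
        prob_space M \<longrightarrow> independent_spread_entries \<rho> n M a \<longrightarrow>
        \<P>(\<omega> in M. singular_mat (random_matrix n a \<omega>)) \<le> C / sqrt (real n))"

end

theory Submission
  imports Defs "Jordan_Normal_Form.Determinant"
begin

text \<open>
  The probability of singularity is an affine function of the law of each single entry, and the law
  of a spread entry is a mixture of three-point laws with weights \<open>\<rho>\<close>, \<open>\<rho>\<close>, \<open>1 - 2\<rho>\<close> whose first two
  atoms differ. Averaging entry by entry, some choice of three-point laws makes singularity at least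
  as likely, so all entries may be assumed to be finitely supported.

  If the matrix is singular then either some kernel vector has at most \<open>s = \<lfloor>c n\<rfloor>\<close> nonzero
  coordinates, or more than \<open>s\<close> columns lie in the span of the others, which by Markov's inequality
  costs a factor \<open>n / (s + 1)\<close> in comparison with a single column. A column lies in the span of the
  others only if it is orthogonal to every normal of them. If some normal has more than \<open>s\<close> nonzero
  coordinates, the Littlewood--Offord bound gives probability \<open>O(1 / sqrt s)\<close>.

  Sparse vectors orthogonal to about \<open>n\<close> independent columns are exponentially unlikely: given an
  \<open>s\<close>-dimensional coordinate subspace, each column cuts the dimension of the surviving subspace with
  probability at least \<open>\<rho>\<close>, so that \<open>2\<close> to the power of that dimension decays on average by the
  factor \<open>1 - \<rho> / 2\<close>, and the entropy of the choice of subspace is small for small \<open>c\<close>.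
\<close>

section \<open>Singular matrices and kernel vectors\<close>

text \<open>Vectors of length \<open>n\<close> are functions on all naturals whose values from
  \<open>n\<close> on are ignored, so a nonempty \<open>supp_below n w\<close> is the way of saying
  that the vector is nonzero.\<close>

definition supp_below :: "nat \<Rightarrow> (nat \<Rightarrow> real) \<Rightarrow> nat set" where
  "supp_below n w = {l. l < n \<and> w l \<noteq> 0}"

lemma finite_supp_below [simp]: "finite (supp_below n w)"
  by (simp add: supp_below_def)

lemma singular_mat_iff_det:
  assumes "A \<in> carrier_mat n n"
  shows "singular_mat A \<longleftrightarrow> det A = 0"
proof -
  have "invertible_mat A \<longleftrightarrow> det A \<noteq> 0"
  proof
    assume "invertible_mat A"
    then obtain B where B: "inverts_mat A B" "inverts_mat B A"
      by (auto simp: invertible_mat_def)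
    have 1: "A * B = 1\<^sub>m n" using B assms by (auto simp: inverts_mat_def)
    \<comment> \<open>\<open>inverts_mat\<close> does not fix the shape of \<open>B\<close>; it is
      read off from the two identity matrices.\<close>
    have "dim_col (A * B) = n" by (simp add: 1)
    then have c: "dim_col B = n" by simp
    have "B * A = 1\<^sub>m (dim_row B)" using B by (auto simp: inverts_mat_def)
    then have "dim_col (B * A) = dim_row B" by simp
    then have "dim_row B = n" using assms by simp
    with c have Bc: "B \<in> carrier_mat n n" by auto
    have "det A * det B = 1"
      using det_mult[OF assms Bc] 1 by simp
    then show "det A \<noteq> 0" by auto
  next
    assume "det A \<noteq> 0"
    from det_non_zero_imp_unit[OF assms this]
    show "invertible_mat A"
      using assms
      unfolding invertible_mat_def Units_def ring_mat_def inverts_mat_def by auto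
  qed
  moreover have "square_mat A" using assms by auto
  ultimately show ?thesis by (simp add: singular_mat_def)
qed

lemma det_zero_iff_kernel:
  "det (Matrix.mat n n f) = 0 \<longleftrightarrow>
     (\<exists>v. supp_below n v \<noteq> {} \<and> (\<forall>i<n. (\<Sum>j<n. f (i, j) * v j) = (0::real)))"
proof -
  have "det (Matrix.mat n n f) = 0 \<longleftrightarrow>
    (\<exists>v. v \<in> carrier_vec n \<and> v \<noteq> 0\<^sub>v n \<and> Matrix.mat n n f *\<^sub>v v = 0\<^sub>v n)"
    by (rule det_0_iff_vec_prod_zero) simp
  also have "\<dots> \<longleftrightarrow> (\<exists>v. supp_below n v \<noteq> {} \<and> (\<forall>i<n. (\<Sum>j<n. f (i, j) * v j) = 0))"
  proof (intro iffI; elim exE conjE)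
    fix v :: "real vec"
    assume v: "v \<in> carrier_vec n" "v \<noteq> 0\<^sub>v n" "Matrix.mat n n f *\<^sub>v v = 0\<^sub>v n"
    have "\<exists>l<n. vec_index v l \<noteq> 0"
      using v(1,2) by (auto simp: vec_eq_iff)
    moreover have "(\<Sum>j<n. f (i, j) * vec_index v j) = 0" if "i < n" for i
    proof -
      have "(Matrix.mat n n f *\<^sub>v v) $ i = 0" using v(3) that by simp
      then show ?thesis using v(1) that
        by (simp add: scalar_prod_def atLeast0LessThan)
    qed
    ultimately show "\<exists>v. supp_below n v \<noteq> {} \<and> (\<forall>i<n. (\<Sum>j<n. f (i, j) * v j) = 0)"
      by (intro exI[of _ "\<lambda>l. vec_index v l"]) (auto simp: supp_below_def)
  next
    fix v :: "nat \<Rightarrow> real"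
    assume v: "supp_below n v \<noteq> {}" "\<forall>i<n. (\<Sum>j<n. f (i, j) * v j) = 0"
    have "Matrix.vec n v \<noteq> 0\<^sub>v n"
      using v(1) by (auto simp: supp_below_def vec_eq_iff)
    moreover have "Matrix.mat n n f *\<^sub>v Matrix.vec n v = 0\<^sub>v n"
      using v(2) by (intro eq_vecI) (auto simp: scalar_prod_def atLeast0LessThan)
    ultimately show "\<exists>v. v \<in> carrier_vec n \<and> v \<noteq> 0\<^sub>v n \<and> Matrix.mat n n f *\<^sub>v v = 0\<^sub>v n"
      by (intro exI[of _ "Matrix.vec n v"]) auto
  qed
  finally show ?thesis .
qed

text \<open>Zeroing column \<open>i\<close> makes the matrix singular, the \<open>i\<close>-th unit
  vector being in its kernel. Its transpose is then singular too, and a kernel vector of the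
  transpose is the normal sought.\<close>

lemma exists_normal_to_other_columns:
  fixes x :: "nat \<times> nat \<Rightarrow> real"
  assumes "i < n"
  shows "\<exists>w. supp_below n w \<noteq> {} \<and> (\<forall>j\<in>{..<n} - {i}. (\<Sum>l<n. w l * x (l, j)) = 0)"
proof -
  let ?f = "\<lambda>(l, j). if j = i then 0 else x (l, j)"
  let ?B = "Matrix.mat n n (\<lambda>(j, l). ?f (l, j))"
  have "det (Matrix.mat n n ?f) = 0"
    unfolding det_zero_iff_kernel using assms
    by (intro exI[of _ "\<lambda>j. if j = i then 1 else 0"])
       (auto simp: supp_below_def intro!: sum.neutral)
  moreover have "?B = transpose_mat (Matrix.mat n n ?f)"
    by (intro eq_matI) auto
  ultimately have "det ?B = 0"
    using det_transpose[of "Matrix.mat n n ?f" n] by simp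
  then obtain w where w: "supp_below n w \<noteq> {}"
    "\<forall>j<n. (\<Sum>l<n. (if j = i then 0 else x (l, j)) * w l) = 0"
    by (auto simp: det_zero_iff_kernel)
  have "(\<Sum>l<n. w l * x (l, j)) = 0" if "j < n" "j \<noteq> i" for j
    using w(2)[rule_format, OF that(1)] that(2) by (simp add: mult.commute)
  with w(1) show ?thesis by auto
qed

text \<open>Multiply the column relation given by \<open>v\<close> with \<open>w\<close>: every term
  \<open>j \<noteq> i\<close> vanishes, and the remaining coefficient \<open>v i\<close> is nonzero.
  Thus each support point of a kernel vector yields a column orthogonal to all normals of the
  others.\<close>

lemma kernel_support_column_in_span:
  fixes x :: "nat \<times> nat \<Rightarrow> real"
  assumes ker: "\<forall>l<n. (\<Sum>j<n. x (l, j) * v j) = 0"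
    and i: "i \<in> supp_below n v"
    and w: "\<forall>j\<in>{..<n} - {i}. (\<Sum>l<n. w l * x (l, j)) = 0"
  shows "(\<Sum>l<n. w l * x (l, i)) = 0"
proof -
  have i': "i < n" "v i \<noteq> 0" using i by (auto simp: supp_below_def)
  have "0 = (\<Sum>l<n. w l * (\<Sum>j<n. x (l, j) * v j))" using ker by simp
  also have "\<dots> = (\<Sum>j<n. v j * (\<Sum>l<n. w l * x (l, j)))"
    unfolding sum_distrib_left by (subst sum.swap) (simp add: mult_ac)
  also have "\<dots> = v i * (\<Sum>l<n. w l * x (l, i)) +
      (\<Sum>j\<in>{..<n} - {i}. v j * (\<Sum>l<n. w l * x (l, j)))"
    using i' by (subst sum.remove[of _ i]) auto
  also have "(\<Sum>j\<in>{..<n} - {i}. v j * (\<Sum>l<n. w l * x (l, j))) = 0"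
    using w by (intro sum.neutral) auto
  finally show ?thesis using i' by auto
qed

section \<open>Conditioning in finite products\<close>

lemma expectation_bind_pmf:
  fixes f :: "'b \<Rightarrow> real"
  assumes "\<And>x. \<bar>f x\<bar> \<le> b"
  shows "measure_pmf.expectation (bind_pmf p q) f =
    measure_pmf.expectation p (\<lambda>x. measure_pmf.expectation (q x) f)"
  unfolding measure_pmf_bind
  by (subst integral_bind[where K = "count_space UNIV" and B = b and B' = 1])
     (use assms in \<open>auto simp: measure_pmf.emeasure_space_1 space_measure_pmf intro!: measure_pmf.finite_measure measure_pmf_in_subprob_algebra\<close>)

lemma prob_Pi_pmf_union:
  assumes "finite A" "finite B" "A \<inter> B = {}"
  shows "measure_pmf.prob (Pi_pmf (A \<union> B) d p) E =
    measure_pmf.expectation (Pi_pmf A d p)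
      (\<lambda>f. measure_pmf.prob (Pi_pmf B d p) {g. (\<lambda>x. if x \<in> A then f x else g x) \<in> E})"
proof -
  let ?m = "\<lambda>f g x. if x \<in> A then f x else g x"
  have eq: "Pi_pmf (A \<union> B) d p = bind_pmf (Pi_pmf A d p) (\<lambda>f. map_pmf (?m f) (Pi_pmf B d p))"
    unfolding Pi_pmf_union[OF assms] pair_pmf_def map_bind_pmf
    by (simp add: map_pmf_def bind_return_pmf)
  have "measure_pmf.prob (Pi_pmf (A \<union> B) d p) E =
    measure_pmf.expectation (Pi_pmf (A \<union> B) d p) (indicator E)" by simp
  also have "\<dots> = measure_pmf.expectation (Pi_pmf A d p)
      (\<lambda>f. measure_pmf.expectation (map_pmf (?m f) (Pi_pmf B d p)) (indicator E))"
    unfolding eq by (rule expectation_bind_pmf[where b = 1]) (simp add: indicator_def)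
  also have "\<dots> = measure_pmf.expectation (Pi_pmf A d p)
      (\<lambda>f. measure_pmf.prob (map_pmf (?m f) (Pi_pmf B d p)) E)" by simp
  also have "\<dots> = measure_pmf.expectation (Pi_pmf A d p)
      (\<lambda>f. measure_pmf.prob (Pi_pmf B d p) {g. ?m f g \<in> E})"
    by (simp add: vimage_def)
  finally show ?thesis .
qed

lemma expectation_pmf_mono:
  fixes f g :: "'a \<Rightarrow> real"
  assumes "\<And>x. f x \<le> g x" "\<And>x. \<bar>f x\<bar> \<le> a" "\<And>x. \<bar>g x\<bar> \<le> b"
  shows "measure_pmf.expectation p f \<le> measure_pmf.expectation p g"
  using assms
  by (intro integral_mono measure_pmf.integrable_const_bound[where B = a]
      measure_pmf.integrable_const_bound[where B = b]) auto

text \<open>The form in which conditioning is used below: the coordinates in \<open>A\<close> are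
  frozen, and a bound uniform in their values survives averaging.\<close>

lemma prob_Pi_pmf_union_le:
  assumes "finite A" "finite B" "A \<inter> B = {}"
    and le: "\<And>f. measure_pmf.prob (Pi_pmf B d p) {g. (\<lambda>x. if x \<in> A then f x else g x) \<in> E} \<le> c"
  shows "measure_pmf.prob (Pi_pmf (A \<union> B) d p) E \<le> c"
proof -
  have "0 \<le> c" using le[of undefined] measure_nonneg by (rule order_trans[rotated])
  then have "measure_pmf.prob (Pi_pmf (A \<union> B) d p) E \<le>
    measure_pmf.expectation (Pi_pmf A d p) (\<lambda>_. c)"
    unfolding prob_Pi_pmf_union[OF assms(1-3)]
    by (intro expectation_pmf_mono[where a = 1 and b = c] le) auto
  then show ?thesis by simp
qed

section \<open>Littlewood--Offord bound for three-point laws\<close>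

text \<open>The three-point law is encoded by its expectations, so that averaging over one entry
  becomes rewriting by a three-term sum. The third atom may coincide with one of the other
  two.\<close>

definition spread_pmf :: "real \<Rightarrow> real pmf \<Rightarrow> bool" where
  "spread_pmf \<rho> p \<longleftrightarrow> (\<exists>u v w. u \<noteq> v \<and>
     (\<forall>f :: real \<Rightarrow> real. measure_pmf.expectation p f = \<rho> * f u + \<rho> * f v + (1 - 2 * \<rho>) * f w))"

text \<open>
  The probability that the lazy walk on the integers with steps \<open>1\<close>, \<open>-1\<close>, \<open>0\<close> of weights \<open>\<rho>\<close>, \<open>\<rho>\<close>,
  \<open>1 - 2\<rho>\<close>, started at \<open>r\<close>, avoids \<open>0\<close> up to time \<open>k\<close>.
\<close>

fun survival :: "real \<Rightarrow> nat \<Rightarrow> nat \<Rightarrow> real" where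
  "survival \<rho> 0 r = (if r = 0 then 0 else 1)"
| "survival \<rho> (Suc k) 0 = 0"
| "survival \<rho> (Suc k) (Suc r) =
     \<rho> * survival \<rho> k (Suc (Suc r)) + \<rho> * survival \<rho> k r + (1 - 2 * \<rho>) * survival \<rho> k (Suc r)"

lemma survival_0 [simp]: "survival \<rho> k 0 = 0"
  by (cases k) auto

text \<open>Distinct translates of a nonempty finite set have different maxima, hence differ. As
  their sizes agree, the intersection is strictly smaller than \<open>A\<close>, and
  inclusion-exclusion gives what it loses to the union.\<close>

lemma translates_union_inter:
  fixes A :: "real set"
  assumes "finite A" "A \<noteq> {}" "a \<noteq> b"
  defines "A1 \<equiv> (\<lambda>x. x - a) ` A" and "A2 \<equiv> (\<lambda>x. x - b) ` A"
  obtains i where "1 \<le> i" "i \<le> card A" "card (A1 \<union> A2) = card A + i" "card (A1 \<inter> A2) = card A - i"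
proof -
  have fin: "finite A1" "finite A2" using assms by auto
  have c: "card A1 = card A" "card A2 = card A"
    unfolding A1_def A2_def by (intro card_image inj_onI; simp)+
  have "A1 \<noteq> A2"
  proof
    assume "A1 = A2"
    moreover have "Max A1 = Max A - a" "Max A2 = Max A - b"
      unfolding A1_def A2_def using assms
      by (intro mono_Max_commute[symmetric]; auto simp: mono_def)+
    ultimately show False using assms(3) by simp
  qed
  then have "A1 \<inter> A2 \<subset> A1"
    using c fin by (metis card_subset_eq inf.absorb_iff2 inf_le1 psubsetI inf_commute)
  then have lt: "card (A1 \<inter> A2) < card A" using psubset_card_mono[OF fin(1)] c by metis
  have "card (A1 \<union> A2) + card (A1 \<inter> A2) = 2 * card A"
    using card_Un_Int[OF fin] c by simp
  with lt show thesis by (intro that[of "card A - card (A1 \<inter> A2)"]) auto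
qed

section \<open>Concavity and decay of the survival probability\<close>

context
  fixes \<rho> :: real
  assumes \<rho>: "0 < \<rho>" "\<rho> < 1 / 2"
begin

lemma survival_bounds: "0 \<le> survival \<rho> k r \<and> survival \<rho> k r \<le> 1"
proof (induction k arbitrary: r)
  case (Suc k)
  show ?case
  proof (cases r)
    case r: (Suc r')
    have "survival \<rho> (Suc k) r \<le> \<rho> * 1 + \<rho> * 1 + (1 - 2 * \<rho>) * 1"
      unfolding r survival.simps using \<rho> Suc by (intro add_mono mult_left_mono) auto
    moreover have "0 \<le> survival \<rho> (Suc k) r"
      unfolding r survival.simps using \<rho> Suc by (intro add_nonneg_nonneg mult_nonneg_nonneg) auto
    ultimately show ?thesis by simp
  qed auto
qed auto

text \<open>The second difference at time \<open>k + 1\<close> is a combination of second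
  differences at time \<open>k\<close>, with weights \<open>\<rho>\<close> and
  \<open>1 - 2 * \<rho>\<close> that are nonnegative.\<close>

lemma survival_concave:
  "survival \<rho> k (Suc (Suc r)) + survival \<rho> k r \<le> 2 * survival \<rho> k (Suc r)"
proof (induction k arbitrary: r)
  case (Suc k)
  define g where "g = survival \<rho> k"
  have IH: "g (Suc (Suc r)) + g r \<le> 2 * g (Suc r)" for r
    using Suc[of r] by (simp add: g_def)
  show ?case
  proof (cases r)
    \<comment> \<open>Next to the absorbing boundary one neighbour drops out of the combination; the
      identity uses \<open>g 0 = 0\<close>.\<close>
    case 0
    have "survival \<rho> (Suc k) (Suc (Suc 0)) + survival \<rho> (Suc k) 0 - 2 * survival \<rho> (Suc k) (Suc 0)
      = (1 - 2 * \<rho>) * (g 2 + g 0 - 2 * g 1) + \<rho> * (g 3 + g 1 - 2 * g 2)"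
      by (simp add: g_def[symmetric] eval_nat_numeral algebra_simps) (simp add: g_def)
    also have "\<dots> \<le> 0 + 0"
      using \<rho> IH[of 0] IH[of 1]
      by (intro add_mono mult_nonneg_nonpos) (auto simp: eval_nat_numeral)
    finally show ?thesis using 0 by simp
  next
    case r: (Suc q)
    have "survival \<rho> (Suc k) (Suc (Suc r)) + survival \<rho> (Suc k) r - 2 * survival \<rho> (Suc k) (Suc r)
      = (1 - 2 * \<rho>) * (g (Suc (Suc r)) + g r - 2 * g (Suc r))
        + \<rho> * (g (Suc (Suc (Suc r))) + g (Suc r) - 2 * g (Suc (Suc r)))
        + \<rho> * (g (Suc r) + g q - 2 * g r)"
      unfolding r by (simp add: g_def[symmetric] algebra_simps)
    also have "\<dots> \<le> 0 + 0 + 0"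
      using \<rho> IH[of r] IH[of "Suc r"] IH[of q] r
      by (intro add_mono mult_nonneg_nonpos) auto
    finally show ?thesis by simp
  qed
qed auto

text \<open>Slopes of a concave sequence do not increase, so moving both arguments one step further
  outward gains on the right at most what is lost on the left.\<close>

lemma survival_spread:
  assumes "1 \<le> i" "i \<le> r"
  shows "survival \<rho> k (r + i) + survival \<rho> k (r - i) \<le> survival \<rho> k (r + 1) + survival \<rho> k (r - 1)"
  using assms
proof (induction i rule: dec_induct)
  case (step i)
  define g where "g = survival \<rho> k"
  have slope: "g (Suc (a + m)) - g (a + m) \<le> g (Suc a) - g a" for a m
  proof (induction m)
    case (Suc m)
    then show ?case using survival_concave[of k "a + m"] by (simp add: g_def)
  qed simp
  have "g (Suc (r + i)) - g (r + i) \<le> g (Suc (r - Suc i)) - g (r - Suc i)"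
    using slope[of "r - Suc i" "Suc (i + i)"] step by simp
  moreover have "Suc (r - Suc i) = r - i" using step by simp
  ultimately show ?case using step unfolding g_def[symmetric] by simp
qed simp

lemma survival_decreasing: "survival \<rho> (Suc k) r \<le> survival \<rho> k r"
proof (cases r)
  case (Suc q)
  have "survival \<rho> (Suc k) r - survival \<rho> k r = \<rho> *
     (survival \<rho> k (Suc (Suc q)) + survival \<rho> k q - 2 * survival \<rho> k (Suc q))"
    by (simp add: Suc algebra_simps)
  also have "\<dots> \<le> 0" using \<rho> survival_concave by (intro mult_nonneg_nonpos) auto
  finally show ?thesis by simp
qed simp

text \<open>
  The occupation sum \<open>F r\<close> over the times \<open>j < k\<close> has second difference at least \<open>- 1 / \<rho>\<close>, vanishes at
  \<open>0\<close> and is at most \<open>k\<close> at \<open>N\<close>, which bounds \<open>F 1\<close>; and \<open>k\<close> times the final value is at most \<open>F 1\<close>.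
\<close>

lemma survival_1_le:
  assumes "N > 0" "k > 0"
  shows "survival \<rho> k 1 \<le> 1 / real N + real N / (2 * \<rho> * real k)"
proof -
  define F where "F r = (\<Sum>j<k. survival \<rho> j r)" for r
  define d where "d r = F (Suc r) - F r" for r
  have F0: "F 0 = 0" by (simp add: F_def)
  \<comment> \<open>The recursion is a discrete heat equation: \<open>\<rho>\<close> times the
    second difference in space is the difference in time, and the latter telescopes over
    \<open>j < k\<close>.\<close>
  have step: "d r - 1 / \<rho> \<le> d (Suc r)" for r
  proof -
    have "\<rho> * (F (Suc (Suc r)) + F r - 2 * F (Suc r)) =
      (\<Sum>j<k. survival \<rho> (Suc j) (Suc r) - survival \<rho> j (Suc r))"
      unfolding F_def by (simp add: sum.distrib sum_subtractf sum_distrib_left algebra_simps)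
    also have "\<dots> = survival \<rho> k (Suc r) - survival \<rho> 0 (Suc r)"
      by (rule sum_lessThan_telescope)
    also have "\<dots> \<ge> - 1" using survival_bounds[of k "Suc r"] by simp
    finally have "- 1 / \<rho> \<le> F (Suc (Suc r)) + F r - 2 * F (Suc r)"
      using \<rho> by (simp add: field_simps)
    then show ?thesis by (simp add: d_def)
  qed
  have d: "d 0 - real r / \<rho> \<le> d r" for r
  proof (induction r)
    case (Suc r)
    then show ?case using step[of r] by (simp add: add_divide_distrib)
  qed simp
  have "F m \<ge> real m * d 0 - real m * real m / (2 * \<rho>)" for m
  proof (induction m)
    case (Suc m)
    have "real (Suc m) * real (Suc m) / (2 * \<rho>) \<ge> real m * real m / (2 * \<rho>) + real m / \<rho>"
      using \<rho> by (simp add: field_simps)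
    then show ?case using Suc d[of m] by (simp add: d_def algebra_simps)
  qed (simp add: F0)
  from this[of N] have "real N * d 0 \<le> F N + real N * real N / (2 * \<rho>)" by simp
  also have "F N \<le> (\<Sum>j<k. 1)" unfolding F_def by (intro sum_mono) (use survival_bounds in auto)
  finally have "d 0 \<le> (real k + real N * real N / (2 * \<rho>)) / real N"
    using assms by (simp add: field_simps)
  also have "\<dots> = real k * (1 / real N + real N / (2 * \<rho> * real k))"
    using assms \<rho> by (simp add: field_simps)
  finally have 1: "d 0 \<le> \<dots>" .
  have mono: "survival \<rho> k 1 \<le> survival \<rho> j 1" if "j \<le> k" for j
    using that by (induction rule: inc_induct) (use survival_decreasing order_trans in blast)+
  have "real k * survival \<rho> k 1 = (\<Sum>j<k. survival \<rho> k 1)" by simp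
  also have "\<dots> \<le> F 1" unfolding F_def by (intro sum_mono mono) auto
  also have "\<dots> = d 0" by (simp add: d_def F0)
  finally have "real k * survival \<rho> k 1 \<le> real k * (1 / real N + real N / (2 * \<rho> * real k))"
    using 1 by simp
  then show ?thesis using assms by (simp only: mult_le_cancel_left_pos of_nat_0_less_iff)
qed

lemma survival_1_le_sqrt:
  assumes "k > 0"
  shows "survival \<rho> k 1 \<le> (1 + 1 / \<rho>) / sqrt (real k)"
proof -
  \<comment> \<open>This order of magnitude balances the terms \<open>1 / N\<close> and
    \<open>N / (2 * \<rho> * k)\<close>.\<close>
  define N where "N = nat \<lceil>sqrt (real k)\<rceil>"
  have s: "sqrt (real k) \<ge> 1" using assms by simp
  have N: "sqrt (real k) \<le> real N" "real N \<le> 2 * sqrt (real k)"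
    using s unfolding N_def by linarith+
  have "N > 0" using N s by (intro gr0I) auto
  have "survival \<rho> k 1 \<le> 1 / real N + real N / (2 * \<rho> * real k)"
    by (rule survival_1_le) fact+
  also have "\<dots> \<le> 1 / sqrt (real k) + 2 * sqrt (real k) / (2 * \<rho> * real k)"
    using N s \<rho> assms \<open>N > 0\<close> by (intro add_mono divide_left_mono divide_right_mono) auto
  also have "2 * sqrt (real k) / (2 * \<rho> * real k) = (1 / \<rho>) / sqrt (real k)"
    using assms \<rho> by (simp add: field_simps)
  finally show ?thesis by (simp add: add_divide_distrib)
qed

text \<open>
  The two translates of \<open>A\<close> by the distinct atoms \<open>u\<close>, \<open>v\<close> are different sets of equal size, so their
  union and intersection have sizes \<open>card A + m\<close> and \<open>card A - m\<close> with \<open>m \<ge> 1\<close>; concavity of the survival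
  probability makes \<open>m = 1\<close> the worst case, and that case is the recursion of the walk.
\<close>

lemma concentration_le_survival:
  fixes w :: "'i \<Rightarrow> real"
  assumes "finite I" "\<And>i. i \<in> I \<Longrightarrow> spread_pmf \<rho> (p i)" "\<And>i. i \<in> I \<Longrightarrow> w i \<noteq> 0" "finite A"
  shows "measure_pmf.prob (Pi_pmf I d p) {x. (\<Sum>i\<in>I. w i * x i) \<in> A} \<le> survival \<rho> (card I) (card A)"
  using assms
proof (induction I arbitrary: A rule: finite_induct)
  case empty
  show ?case by (cases "A = {}") (use empty in \<open>auto simp: card_gt_0_iff\<close>)
next
  case (insert i I)
  define Q where "Q B = measure_pmf.prob (Pi_pmf I d p) {x. (\<Sum>i\<in>I. w i * x i) \<in> B}" for B
  \<comment> \<open>If entry \<open>i\<close> takes the value \<open>a\<close>, the remaining sum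
    must hit the translate \<open>T a\<close>.\<close>
  define T where "T a = (\<lambda>x. x - w i * a) ` A" for a
  have IH: "Q B \<le> survival \<rho> (card I) (card B)" if "finite B" for B
    unfolding Q_def using insert that by auto
  have finT: "finite (T a)" for a by (simp add: T_def insert)
  have cardT: "card (T a) = card A" for a
    unfolding T_def by (intro card_image inj_onI) simp
  obtain u v z where uvz: "u \<noteq> v" and
    E: "\<And>f :: real \<Rightarrow> real. measure_pmf.expectation (p i) f = \<rho> * f u + \<rho> * f v + (1 - 2 * \<rho>) * f z"
    using insert(4)[of i] unfolding spread_pmf_def by auto
  have "measure_pmf.prob (Pi_pmf (insert i I) d p) {x. (\<Sum>i\<in>insert i I. w i * x i) \<in> A} =
    measure_pmf.expectation (Pi_pmf {i} d p) (\<lambda>f. measure_pmf.prob (Pi_pmf I d p)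
      {g. (\<lambda>x. if x \<in> {i} then f x else g x) \<in> {x. (\<Sum>i\<in>insert i I. w i * x i) \<in> A}})"
    using prob_Pi_pmf_union[of "{i}" I d p] insert by simp
  also have "\<dots> = measure_pmf.expectation (p i) (\<lambda>a. measure_pmf.prob (Pi_pmf I d p)
      {g. (\<Sum>j\<in>insert i I. w j * (if j = i then a else g j)) \<in> A})"
    by (simp add: Pi_pmf_singleton cong: if_cong)
  also have "\<dots> = measure_pmf.expectation (p i) (\<lambda>a. Q (T a))"
  proof -
    have "{g. (\<Sum>j\<in>insert i I. w j * (if j = i then a else g j)) \<in> A} = {x. (\<Sum>j\<in>I. w j * x j) \<in> T a}" for a
    proof -
      have "(\<Sum>j\<in>insert i I. w j * (if j = i then a else g j)) = w i * a + (\<Sum>j\<in>I. w j * g j)" for g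
        using insert by (auto simp: intro!: sum.cong)
      moreover have "w i * a + s \<in> A \<longleftrightarrow> s \<in> T a" for s
        by (auto simp: T_def image_iff algebra_simps)
      ultimately show ?thesis by simp
    qed
    then show ?thesis by (simp add: Q_def)
  qed
  also have "\<dots> = \<rho> * (Q (T u) + Q (T v)) + (1 - 2 * \<rho>) * Q (T z)"
    by (simp add: E algebra_simps)
  also have "\<dots> \<le> survival \<rho> (Suc (card I)) (card A)"
  proof (cases "A = {}")
    case True
    then show ?thesis by (simp add: T_def Q_def)
  next
    case False
    have wuv: "w i * u \<noteq> w i * v" using uvz insert(5)[of i] by simp
    obtain m where m: "1 \<le> m" "m \<le> card A"
      "card (T u \<union> T v) = card A + m" "card (T u \<inter> T v) = card A - m"
      using translates_union_inter[OF insert(6) False wuv] unfolding T_def by metis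
    obtain r where r: "card A = Suc r" using m by (cases "card A") auto
    \<comment> \<open>Inclusion-exclusion trades the two translates for their union and
      intersection, whose unequal sizes can be fed into the induction hypothesis.\<close>
    have "Q (T u) + Q (T v) = Q (T u \<union> T v) + Q (T u \<inter> T v)"
      unfolding Q_def
      using measure_Un3[of "{x. (\<Sum>i\<in>I. w i * x i) \<in> T u}" "measure_pmf (Pi_pmf I d p)"
          "{x. (\<Sum>i\<in>I. w i * x i) \<in> T v}"]
      by (simp add: measure_pmf.fmeasurable_eq_sets Un_def Int_def)
    also have "\<dots> \<le> survival \<rho> (card I) (card A + m) + survival \<rho> (card I) (card A - m)"
      using IH[of "T u \<union> T v"] IH[of "T u \<inter> T v"] finT m by auto
    also have "\<dots> \<le> survival \<rho> (card I) (card A + 1) + survival \<rho> (card I) (card A - 1)"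
      using m by (intro survival_spread)
    finally have "\<rho> * (Q (T u) + Q (T v)) \<le>
      \<rho> * (survival \<rho> (card I) (card A + 1) + survival \<rho> (card I) (card A - 1))"
      using \<rho> by (intro mult_left_mono) auto
    moreover have "(1 - 2 * \<rho>) * Q (T z) \<le> (1 - 2 * \<rho>) * survival \<rho> (card I) (card A)"
      using IH[OF finT, of z] cardT \<rho> by (intro mult_left_mono) auto
    ultimately have "\<rho> * (Q (T u) + Q (T v)) + (1 - 2 * \<rho>) * Q (T z) \<le>
      \<rho> * (survival \<rho> (card I) (card A + 1) + survival \<rho> (card I) (card A - 1)) +
      (1 - 2 * \<rho>) * survival \<rho> (card I) (card A)"
      by (rule add_mono)
    then show ?thesis by (simp add: r algebra_simps)
  qed
  finally show ?case using insert by simp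
qed

text \<open>With the coordinates outside \<open>K\<close> frozen, the part of the form over
  \<open>K\<close> has to hit a single value, so the comparison walk starts at
  \<open>1\<close>.\<close>

lemma linear_form_zero_le:
  fixes w :: "'i \<Rightarrow> real"
  assumes "finite I" "\<And>i. i \<in> I \<Longrightarrow> spread_pmf \<rho> (p i)" "K \<subseteq> I" "\<And>i. i \<in> K \<Longrightarrow> w i \<noteq> 0"
  shows "measure_pmf.prob (Pi_pmf I d p) {x. (\<Sum>i\<in>I. w i * x i) = 0} \<le> survival \<rho> (card K) 1"
proof -
  have "measure_pmf.prob (Pi_pmf ((I - K) \<union> K) d p) {x. (\<Sum>i\<in>I. w i * x i) = 0} \<le> survival \<rho> (card K) 1"
  proof (rule prob_Pi_pmf_union_le)
    fix f :: "'i \<Rightarrow> real"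
    let ?c = "- (\<Sum>i\<in>I - K. w i * f i)"
    have "(\<Sum>i\<in>I. w i * (if i \<in> I - K then f i else g i)) =
       (\<Sum>i\<in>I - K. w i * f i) + (\<Sum>i\<in>K. w i * g i)" for g
      using assms by (subst sum.subset_diff[of K I]) (auto intro!: sum.cong)
    then have "{g. (\<lambda>x. if x \<in> I - K then f x else g x) \<in> {x. (\<Sum>i\<in>I. w i * x i) = 0}} =
      {g. (\<Sum>i\<in>K. w i * g i) \<in> {?c}}"
      by auto
    also have "measure_pmf.prob (Pi_pmf K d p) \<dots> \<le> survival \<rho> (card K) (card {?c})"
      using assms by (intro concentration_le_survival) (auto dest: finite_subset)
    finally show "measure_pmf.prob (Pi_pmf K d p)
      {g. (\<lambda>x. if x \<in> I - K then f x else g x) \<in> {x. (\<Sum>i\<in>I. w i * x i) = 0}} \<le> survival \<rho> (card K) 1"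
      by simp
  qed (use assms in \<open>auto dest: finite_subset\<close>)
  moreover have "(I - K) \<union> K = I" using assms by auto
  ultimately show ?thesis by simp
qed

end

section \<open>Sparse vectors orthogonal to many columns\<close>

text \<open>The family \<open>b\<close> is a spanning family, not necessarily a basis, so
  \<open>d\<close> is an upper bound for the dimension.\<close>

definition span_below :: "nat \<Rightarrow> nat \<Rightarrow> (nat \<Rightarrow> nat \<Rightarrow> real) \<Rightarrow> (nat \<Rightarrow> real) set" where
  "span_below n d b = {w. \<exists>c. \<forall>l<n. w l = (\<Sum>i<d. c i * b i l)}"

text \<open>One elimination step: \<open>b i\<close> is the pivot, and a multiple of it is
  subtracted from each other vector to make that vector orthogonal to \<open>x\<close>. For a
  combination orthogonal to \<open>x\<close> the subtracted multiples cancel in total.\<close>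

lemma span_below_orthogonal:
  assumes "i < d" "(\<Sum>l<n. b i l * x l) \<noteq> 0"
  obtains b' where
    "\<And>w. w \<in> span_below n d b \<Longrightarrow> (\<Sum>l<n. w l * x l) = 0 \<Longrightarrow> w \<in> span_below n (d - 1) b'"
proof -
  define y where "y j = (\<Sum>l<n. b j l * x l)" for j
  have yi: "y i \<noteq> 0" using assms by (simp add: y_def)
  define b'' where "b'' j l = b j l - y j / y i * b i l" for j l
  \<comment> \<open>Enumerates the indices below \<open>d\<close> while skipping the pivot
    \<open>i\<close>, whose modified vector \<open>b'' i\<close> is zero.\<close>
  define h where "h k = (if k < i then k else Suc k)" for k
  have h: "bij_betw h {..<d - 1} ({..<d} - {i})"
    unfolding h_def
    by (rule bij_betw_byWitness[where f' = "\<lambda>k. if k < i then k else k - 1"])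
       (use assms(1) in \<open>auto split: if_splits\<close>)
  show thesis
  proof (rule that[of "\<lambda>k. b'' (h k)"])
    fix w assume "w \<in> span_below n d b" and orth: "(\<Sum>l<n. w l * x l) = 0"
    then obtain c where c: "\<forall>l<n. w l = (\<Sum>j<d. c j * b j l)" by (auto simp: span_below_def)
    have "0 = (\<Sum>l<n. (\<Sum>j<d. c j * b j l) * x l)" using c orth by simp
    also have "\<dots> = (\<Sum>j<d. c j * y j)"
      unfolding sum_distrib_right y_def sum_distrib_left
      by (subst sum.swap) (simp add: mult_ac)
    finally have cy: "(\<Sum>j<d. c j * y j) = 0" by simp
    have "w l = (\<Sum>k<d - 1. c (h k) * b'' (h k) l)" if "l < n" for l
    proof -
      have "(\<Sum>k<d - 1. c (h k) * b'' (h k) l) = (\<Sum>j\<in>{..<d} - {i}. c j * b'' j l)"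
        by (rule sum.reindex_bij_betw[OF h])
      also have "\<dots> = (\<Sum>j<d. c j * b'' j l)"
        using yi assms(1) by (intro sum.mono_neutral_left) (auto simp: b''_def)
      also have "\<dots> = (\<Sum>j<d. c j * b j l) - (\<Sum>j<d. c j * y j) / y i * b i l"
        by (simp add: b''_def algebra_simps sum_subtractf sum_distrib_left sum_distrib_right sum_divide_distrib)
      finally show ?thesis using cy c that by simp
    qed
    then show "w \<in> span_below n (d - 1) (\<lambda>k. b'' (h k))" by (auto simp: span_below_def)
  qed
qed

lemma sum_column: "(\<Sum>l<n. f l (l, j)) = (\<Sum>z\<in>{..<n::nat} \<times> {j}. f (fst z) z)"
  by (rule sum.reindex_bij_witness[of _ fst "\<lambda>l. (l, j)"]) auto

lemma supported_in_span_below: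
  assumes "S \<subseteq> {..<n}" "supp_below n w \<subseteq> S" "bij_betw h {..<d} S"
  shows "w \<in> span_below n d (\<lambda>i l. if l = h i then 1 else 0)"
proof -
  have "w l = (\<Sum>i<d. w (h i) * (if l = h i then 1 else 0))" if "l < n" for l
  proof -
    have "(\<Sum>i<d. w (h i) * (if l = h i then 1 else 0)) = (\<Sum>t\<in>S. w t * (if l = t then 1 else 0))"
      by (rule sum.reindex_bij_betw[OF assms(3)])
    also have "\<dots> = (if l \<in> S then w l else 0)"
      using assms finite_subset[of S "{..<n}"] by (simp add: if_distrib sum.delta cong: if_cong)
    also have "\<dots> = w l" using assms(2) that by (auto simp: supp_below_def)
    finally show ?thesis by simp
  qed
  then show ?thesis by (auto simp: span_below_def)
qed

section \<open>Sparse normals are exponentially unlikely\<close>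

context
  fixes \<rho> :: real
  assumes \<rho>: "0 < \<rho>" "\<rho> < 1 / 2"
begin

lemma column_orthogonal_le:
  assumes "\<And>l. l < n \<Longrightarrow> spread_pmf \<rho> (p (l, j))"
  shows "measure_pmf.prob (Pi_pmf ({..<n} \<times> {j}) d p) {x. (\<Sum>l<n. w l * x (l, j)) = 0}
    \<le> survival \<rho> (card (supp_below n w)) 1"
proof -
  have "(\<Sum>l<n. w l * x (l, j)) = (\<Sum>z\<in>{..<n} \<times> {j}. w (fst z) * x z)" for x
    by (rule sum_column)
  then have "measure_pmf.prob (Pi_pmf ({..<n} \<times> {j}) d p) {x. (\<Sum>l<n. w l * x (l, j)) = 0} =
    measure_pmf.prob (Pi_pmf ({..<n} \<times> {j}) d p) {x. (\<Sum>z\<in>{..<n} \<times> {j}. w (fst z) * x z) = 0}"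
    by simp
  also have "\<dots> \<le> survival \<rho> (card (supp_below n w \<times> {j})) 1"
    using assms by (intro linear_form_zero_le \<rho>) (auto simp: supp_below_def)
  finally show ?thesis by simp
qed

text \<open>The columns are revealed one at a time, with \<open>2 ^ d\<close> as potential. While
  some spanning vector is nonzero, a column fails to lower \<open>d\<close> with probability at most
  \<open>1 - \<rho>\<close>, so the potential is multiplied on average by at most
  \<open>(1 + (1 - \<rho>)) / 2 = 1 - \<rho> / 2\<close>.\<close>

lemma subspace_kernel_le:
  assumes "finite J" "\<And>l j. l < n \<Longrightarrow> j \<in> J \<Longrightarrow> spread_pmf \<rho> (p (l, j))"
  shows "measure_pmf.prob (Pi_pmf ({..<n} \<times> J) \<delta> p)
     {x. \<exists>w\<in>span_below n d b. supp_below n w \<noteq> {} \<and> (\<forall>j\<in>J. (\<Sum>l<n. w l * x (l, j)) = 0)}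
     \<le> 2 ^ d * (1 - \<rho> / 2) ^ card J"
  using assms
proof (induction J arbitrary: d b rule: finite_induct)
  case empty
  have "measure_pmf.prob (Pi_pmf ({..<n} \<times> {}) \<delta> p) E \<le> 2 ^ d" for E
    by (rule order_trans[OF measure_pmf.prob_le_1]) simp
  then show ?case by simp
next
  case (insert j J)
  let ?K = "\<lambda>J d b. {x. \<exists>w\<in>span_below n d b. supp_below n w \<noteq> {} \<and> (\<forall>j\<in>J. (\<Sum>l<n. w l * x (l, j)) = 0)}"
  let ?P = "\<lambda>J. measure_pmf.prob (Pi_pmf ({..<n} \<times> J) \<delta> p)"
  let ?m = "\<lambda>f g z. if z \<in> {..<n} \<times> {j} then f z else g z"
  define \<beta> where "\<beta> = (1 - \<rho> / 2) ^ card J"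
  have \<beta>: "0 \<le> \<beta>" using \<rho> by (simp add: \<beta>_def)
  have IH: "?P J (?K J d b) \<le> 2 ^ d * \<beta>" for d b
    unfolding \<beta>_def using insert by auto
  show ?case
  proof (cases "\<exists>i<d. supp_below n (b i) \<noteq> {}")
    case False
    have "supp_below n w = {}" if "w \<in> span_below n d b" for w
    proof -
      from that obtain c where "\<forall>l<n. w l = (\<Sum>i<d. c i * b i l)" by (auto simp: span_below_def)
      moreover have "\<forall>l<n. \<forall>i<d. b i l = 0" using False by (auto simp: supp_below_def)
      ultimately show ?thesis by (auto simp: supp_below_def)
    qed
    then have empty: "?K (insert j J) d b = {}" by blast
    show ?thesis unfolding empty using \<rho> by simp
  next
    case True
    then obtain i where i: "i < d" "supp_below n (b i) \<noteq> {}" by blast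
    \<comment> \<open>The event that the new column leaves the whole space intact.\<close>
    define Z where "Z = {f. \<forall>k<d. (\<Sum>l<n. b k l * f (l, j)) = 0}"
    have Z: "?P {j} Z \<le> 1 - \<rho>"
    proof -
      have "?P {j} Z \<le> ?P {j} {f. (\<Sum>l<n. b i l * f (l, j)) = 0}"
        using i by (intro measure_pmf.finite_measure_mono) (auto simp: Z_def)
      also obtain l where l: "l \<in> supp_below n (b i)" using i by auto
      \<comment> \<open>One nonzero coefficient is enough, because one step of the walk from
        \<open>1\<close> survives with probability exactly \<open>1 - \<rho>\<close>.\<close>
      have "?P {j} {f. (\<Sum>l<n. b i l * f (l, j)) = 0} \<le> survival \<rho> (card {(l, j)}) 1"
      proof -
        have "(\<Sum>l<n. b i l * x (l, j)) = (\<Sum>z\<in>{..<n} \<times> {j}. b i (fst z) * x z)" for x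
          by (rule sum_column)
        then show ?thesis
          using linear_form_zero_le[OF \<rho>, of "{..<n} \<times> {j}" p "{(l, j)}" "\<lambda>z. b i (fst z)" \<delta>] insert l
          by (auto simp: supp_below_def)
      qed
      finally show ?thesis by simp
    qed
    have eq: "{..<n} \<times> {j} \<union> {..<n} \<times> J = {..<n} \<times> insert j J" by auto
    have "?P (insert j J) (?K (insert j J) d b) =
      measure_pmf.expectation (Pi_pmf ({..<n} \<times> {j}) \<delta> p)
        (\<lambda>f. ?P J {g. ?m f g \<in> ?K (insert j J) d b})"
      using prob_Pi_pmf_union[of "{..<n} \<times> {j}" "{..<n} \<times> J" \<delta> p "?K (insert j J) d b"] insert
      unfolding eq by auto
    also have "\<dots> \<le> measure_pmf.expectation (Pi_pmf ({..<n} \<times> {j}) \<delta> p)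
        (\<lambda>f. 2 ^ (d - 1) * \<beta> * (1 + indicator Z f))"
    proof (rule expectation_pmf_mono[where a = 1 and b = "2 ^ (d - 1) * \<beta> * 2"])
      fix f
      have sub: "?m f g \<in> ?K (insert j J) d b \<longleftrightarrow>
         (\<exists>w\<in>span_below n d b. supp_below n w \<noteq> {} \<and> (\<Sum>l<n. w l * f (l, j)) = 0 \<and>
           (\<forall>j\<in>J. (\<Sum>l<n. w l * g (l, j)) = 0))" for g
      proof -
        have "(\<Sum>l<n. w l * ?m f g (l, j')) = (\<Sum>l<n. w l * g (l, j'))" if "j' \<in> J" for j' w
          using insert that by (intro sum.cong) auto
        moreover have "(\<Sum>l<n. w l * ?m f g (l, j)) = (\<Sum>l<n. w l * f (l, j))" for w
          by (intro sum.cong) auto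
        ultimately show ?thesis by (simp cong: ball_cong)
      qed
      show "?P J {g. ?m f g \<in> ?K (insert j J) d b} \<le> 2 ^ (d - 1) * \<beta> * (1 + indicator Z f)"
      proof (cases "f \<in> Z")
        case True
        have "?P J {g. ?m f g \<in> ?K (insert j J) d b} \<le> ?P J (?K J d b)"
          unfolding sub by (intro measure_pmf.finite_measure_mono) auto
        also have "\<dots> \<le> 2 ^ d * \<beta>" by (rule IH)
        also have "\<dots> = 2 ^ (d - 1) * \<beta> * 2" using i(1) by (cases d) auto
        finally show ?thesis using True by simp
      next
        case False
        then obtain k where "k < d" "(\<Sum>l<n. b k l * f (l, j)) \<noteq> 0" by (auto simp: Z_def)
        then obtain b' where "\<And>w. w \<in> span_below n d b \<Longrightarrow> (\<Sum>l<n. w l * f (l, j)) = 0 \<Longrightarrow>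
          w \<in> span_below n (d - 1) b'"
          using span_below_orthogonal[where i = k and d = d and n = n and b = b and x = "\<lambda>l. f (l, j)"] by metis
        then have "?P J {g. ?m f g \<in> ?K (insert j J) d b} \<le> ?P J (?K J (d - 1) b')"
          unfolding sub by (intro measure_pmf.finite_measure_mono) auto
        also have "\<dots> \<le> 2 ^ (d - 1) * \<beta>" by (rule IH)
        finally show ?thesis using False by simp
      qed
    qed (use \<beta> in \<open>auto simp: indicator_def\<close>)
    also have "\<dots> = 2 ^ (d - 1) * \<beta> * (1 + ?P {j} Z)"
      by (simp add: measure_pmf.integrable_const_bound[where B = 1])
    also have "\<dots> \<le> 2 ^ (d - 1) * \<beta> * (2 - \<rho>)"
      using Z \<beta> by (intro mult_left_mono) auto
    also have "\<dots> = 2 ^ d * (1 - \<rho> / 2) ^ card (insert j J)"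
      using i(1) insert by (cases d) (auto simp: \<beta>_def field_simps)
    finally show ?thesis .
  qed
qed

text \<open>Union bound over coordinate subspaces. Since \<open>s \<le> n\<close>, every smaller
  support can be padded to a set of exactly \<open>s\<close> coordinates, which leaves
  \<open>n choose s\<close> cases.\<close>

lemma sparse_kernel_le:
  assumes "finite J" "\<And>l j. l < n \<Longrightarrow> j \<in> J \<Longrightarrow> spread_pmf \<rho> (p (l, j))" "s \<le> n"
  shows "measure_pmf.prob (Pi_pmf ({..<n} \<times> J) \<delta> p)
     {x. \<exists>w. supp_below n w \<noteq> {} \<and> card (supp_below n w) \<le> s \<and> (\<forall>j\<in>J. (\<Sum>l<n. w l * x (l, j)) = 0)}
     \<le> real (n choose s) * 2 ^ s * (1 - \<rho> / 2) ^ card J"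
proof -
  let ?P = "measure_pmf.prob (Pi_pmf ({..<n} \<times> J) \<delta> p)"
  define \<S> where "\<S> = {S. S \<subseteq> {..<n} \<and> card S = s}"
  define K where "K S = {x. \<exists>w. supp_below n w \<noteq> {} \<and> supp_below n w \<subseteq> S \<and>
     (\<forall>j\<in>J. (\<Sum>l<n. w l * x (l, j)) = (0::real))}" for S
  have fin: "finite \<S>" by (simp add: \<S>_def)
  have K: "?P (K S) \<le> 2 ^ s * (1 - \<rho> / 2) ^ card J" if "S \<in> \<S>" for S
  proof -
    have S: "S \<subseteq> {..<n}" "card S = s" using that by (auto simp: \<S>_def)
    then have "finite S" using finite_subset by blast
    from ex_bij_betw_nat_finite[OF this] S obtain h where h: "bij_betw h {..<s} S"
      by (auto simp: atLeast0LessThan)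
    have "?P (K S) \<le> ?P {x. \<exists>w\<in>span_below n s (\<lambda>i l. if l = h i then 1 else 0).
       supp_below n w \<noteq> {} \<and> (\<forall>j\<in>J. (\<Sum>l<n. w l * x (l, j)) = 0)}"
      using supported_in_span_below[OF S(1) _ h]
      by (intro measure_pmf.finite_measure_mono) (auto simp: K_def)
    also have "\<dots> \<le> 2 ^ s * (1 - \<rho> / 2) ^ card J"
      using assms by (intro subspace_kernel_le)
    finally show ?thesis .
  qed
  have "?P {x. \<exists>w. supp_below n w \<noteq> {} \<and> card (supp_below n w) \<le> s \<and> (\<forall>j\<in>J. (\<Sum>l<n. w l * x (l, j)) = 0)}
    \<le> ?P (\<Union>S\<in>\<S>. K S)"
  proof (intro measure_pmf.finite_measure_mono subsetI)
    fix x
    assume "x \<in> {x. \<exists>w. supp_below n w \<noteq> {} \<and> card (supp_below n w) \<le> s \<and> (\<forall>j\<in>J. (\<Sum>l<n. w l * x (l, j)) = 0)}"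
    then obtain w where w: "supp_below n w \<noteq> {}" "card (supp_below n w) \<le> s"
      "\<forall>j\<in>J. (\<Sum>l<n. w l * x (l, j)) = 0" by auto
    obtain S where S: "supp_below n w \<subseteq> S" "S \<subseteq> {..<n}" "card S = s"
      using exists_subset_between[of "supp_below n w" s "{..<n}"] w(2) assms(3)
      by (auto simp: supp_below_def)
    have "S \<in> \<S>" using S by (simp add: \<S>_def)
    moreover have "x \<in> K S" using S w unfolding K_def by blast
    ultimately show "x \<in> (\<Union>S\<in>\<S>. K S)" by blast
  qed simp
  also have "\<dots> \<le> (\<Sum>S\<in>\<S>. ?P (K S))"
    by (intro measure_pmf.finite_measure_subadditive_finite fin) auto
  also have "\<dots> \<le> (\<Sum>S\<in>\<S>. 2 ^ s * (1 - \<rho> / 2) ^ card J)"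
    by (intro sum_mono K)
  also have "\<dots> = real (n choose s) * 2 ^ s * (1 - \<rho> / 2) ^ card J"
    using n_subsets[of "{..<n}" s] by (simp add: \<S>_def)
  finally show ?thesis .
qed

end

section \<open>Matrices with three-point entries\<close>

text \<open>Transposing only rearranges the independent entries; this lets the bound for columns be
  applied to rows.\<close>

lemma Pi_pmf_swap:
  assumes "finite A"
  shows "map_pmf (\<lambda>x z. x (prod.swap z)) (Pi_pmf (A \<times> A) d p) = Pi_pmf (A \<times> A) d (\<lambda>z. p (prod.swap z))"
proof (rule pmf_eqI)
  fix f :: "'a \<times> 'a \<Rightarrow> 'b"
  let ?h = "\<lambda>x z. x (prod.swap z)"
  have inj: "inj (?h :: ('a \<times> 'a \<Rightarrow> 'b) \<Rightarrow> _)"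
    by (rule inj_on_inverseI[where g = ?h]) simp
  have "pmf (map_pmf ?h (Pi_pmf (A \<times> A) d p)) f = pmf (map_pmf ?h (Pi_pmf (A \<times> A) d p)) (?h (?h f))"
    by simp
  also have "\<dots> = pmf (Pi_pmf (A \<times> A) d p) (?h f)"
    by (rule pmf_map_inj'[OF inj])
  also have "\<dots> = pmf (Pi_pmf (A \<times> A) d (\<lambda>z. p (prod.swap z))) f"
  proof -
    have outside: "(\<forall>x. x \<notin> A \<times> A \<longrightarrow> ?h f x = d) \<longleftrightarrow> (\<forall>x. x \<notin> A \<times> A \<longrightarrow> f x = d)"
      by (metis SigmaE SigmaI swap_simp swap_swap)
    have weight: "(\<Prod>x\<in>A \<times> A. pmf (p x) (?h f x)) = (\<Prod>x\<in>A \<times> A. pmf (p (prod.swap x)) (f x))"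
      by (rule prod.reindex_bij_witness[of _ prod.swap prod.swap]) auto
    show ?thesis
      unfolding pmf_Pi[OF finite_cartesian_product[OF assms assms]] outside weight ..
  qed
  finally show "pmf (map_pmf ?h (Pi_pmf (A \<times> A) d p)) f = \<dots>" .
qed

text \<open>Markov's inequality for the number of events \<open>G i\<close> that occur.\<close>

lemma prob_at_least_le:
  assumes "finite I" "m > 0"
  shows "measure_pmf.prob P {x. m \<le> card {i\<in>I. x \<in> G i}} \<le> (\<Sum>i\<in>I. measure_pmf.prob P (G i)) / real m"
proof -
  let ?Z = "{x. m \<le> card {i\<in>I. x \<in> G i}}"
  have card: "real (card {i\<in>I. x \<in> G i}) = (\<Sum>i\<in>I. indicator (G i) x)" for x
    using assms(1) by (simp add: indicator_def sum.If_cases Int_def)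
  have "real m * measure_pmf.prob P ?Z = measure_pmf.expectation P (\<lambda>x. real m * indicator ?Z x)"
    by simp
  also have "\<dots> \<le> measure_pmf.expectation P (\<lambda>x. \<Sum>i\<in>I. indicator (G i) x)"
  proof (rule expectation_pmf_mono)
    show "real m * indicator ?Z x \<le> (\<Sum>i\<in>I. indicator (G i) x)" for x
      unfolding card[symmetric] by (auto simp: indicator_def)
    show "\<bar>real m * indicator ?Z x\<bar> \<le> real m" for x by (auto simp: indicator_def)
    show "\<bar>\<Sum>i\<in>I. indicator (G i) x :: real\<bar> \<le> card I" for x
      unfolding card[symmetric] using assms(1) by (auto intro!: card_mono)
  qed
  also have "\<dots> = (\<Sum>i\<in>I. measure_pmf.prob P (G i))"
    by (subst Bochner_Integration.integral_sum)
       (auto intro!: measure_pmf.integrable_const_bound[where B = 1])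
  finally show ?thesis using assms(2) by (simp add: field_simps)
qed

text \<open>A single term of the binomial expansion of \<open>(1 + 2 * t) ^ n\<close>. The parameter
  \<open>t\<close> is left free so that both factors on the right can later be made to grow
  slowly.\<close>

lemma binomial_weight_le:
  assumes "0 < t"
  shows "real (n choose s) * 2 ^ s \<le> (1 + 2 * t) ^ n * (1 / t) ^ s"
proof (cases "s \<le> n")
  case True
  have "real (n choose s) * (2 * t) ^ s \<le> (\<Sum>k\<le>n. real (n choose k) * (2 * t) ^ k * 1 ^ (n - k))"
    using member_le_sum[of s "{..n}" "\<lambda>k. real (n choose k) * (2 * t) ^ k"] True assms by simp
  also have "\<dots> = (2 * t + 1) ^ n" by (simp only: binomial_ring)
  finally show ?thesis using assms by (simp add: power_mult_distrib field_simps)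
next
  case False
  then show ?thesis using assms by (simp add: binomial_eq_0)
qed

context
  fixes \<rho> :: real
  assumes \<rho>: "0 < \<rho>" "\<rho> < 1 / 2"
begin

text \<open>A kernel vector is either sparse or has more than \<open>s\<close> support points, each
  giving a column in the span of the others; Markov's inequality handles the second case. The
  exponent \<open>n - 1\<close> in \<open>\<beta>\<close> counts the columns that remain when one is
  set aside.\<close>

lemma singular_prob_le:
  fixes p :: "nat \<times> nat \<Rightarrow> real pmf"
  assumes p: "\<And>i j. i < n \<Longrightarrow> j < n \<Longrightarrow> spread_pmf \<rho> (p (i, j))" and s: "s \<le> n"
  defines "\<beta> \<equiv> real (n choose s) * 2 ^ s * (1 - \<rho> / 2) ^ (n - 1)"
  shows "measure_pmf.prob (Pi_pmf ({..<n} \<times> {..<n}) d p) {x. det (Matrix.mat n n x) = 0} \<le>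
    \<beta> + real n * (\<beta> + (1 + 1 / \<rho>) / sqrt (real (Suc s))) / real (Suc s)"
proof -
  let ?I = "{..<n} \<times> {..<n}"
  let ?P = "measure_pmf.prob (Pi_pmf ?I d p)"
  define sparse where "sparse w \<longleftrightarrow> supp_below n w \<noteq> {} \<and> card (supp_below n w) \<le> s" for w
  \<comment> \<open>\<open>R\<close>: some kernel vector is sparse. \<open>L i\<close>: the columns
    other than \<open>i\<close> have a sparse normal. \<open>F i\<close>: they have none, and column
    \<open>i\<close> is orthogonal to all their normals.\<close>
  define R where "R = {x. \<exists>v. sparse v \<and> (\<forall>l<n. (\<Sum>j<n. v j * x (l, j)) = 0)}"
  define L where "L i = {x. \<exists>w. sparse w \<and> (\<forall>j\<in>{..<n} - {i}. (\<Sum>l<n. w l * x (l, j)) = 0)}" for i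
  define F where "F i = {x. x \<notin> L i \<and>
    (\<forall>w. (\<forall>j\<in>{..<n} - {i}. (\<Sum>l<n. w l * x (l, j)) = 0) \<longrightarrow> (\<Sum>l<n. w l * x (l, i)) = 0)}" for i
  have R: "?P R \<le> \<beta>"
  proof -
    have "?P R = measure_pmf.prob (map_pmf (\<lambda>x z. x (prod.swap z)) (Pi_pmf ?I d p))
       {x. \<exists>w. supp_below n w \<noteq> {} \<and> card (supp_below n w) \<le> s \<and> (\<forall>j\<in>{..<n}. (\<Sum>l<n. w l * x (l, j)) = 0)}"
      by (simp add: vimage_def R_def sparse_def conj_assoc Ball_def)
    also have "\<dots> \<le> real (n choose s) * 2 ^ s * (1 - \<rho> / 2) ^ card {..<n}"
      unfolding Pi_pmf_swap[OF finite_lessThan] using p s by (intro sparse_kernel_le \<rho>) auto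
    also have "\<dots> \<le> \<beta>"
      unfolding \<beta>_def using \<rho> by (intro mult_left_mono power_decreasing) auto
    finally show ?thesis .
  qed
  have LF: "?P (L i \<union> F i) \<le> \<beta> + (1 + 1 / \<rho>) / sqrt (real (Suc s))" if i: "i < n" for i
  proof -
    let ?J = "{..<n} - {i}"
    have eqs: "{..<n} \<times> {i} \<union> {..<n} \<times> ?J = ?I" "{..<n} \<times> ?J \<union> {..<n} \<times> {i} = ?I" using i by auto
    have "measure_pmf.prob (Pi_pmf ({..<n} \<times> {i} \<union> {..<n} \<times> ?J) d p) (L i) \<le> \<beta>"
    proof (rule prob_Pi_pmf_union_le)
      fix f :: "nat \<times> nat \<Rightarrow> real"
      have "(\<Sum>l<n. w l * (if (l, j) \<in> {..<n} \<times> {i} then f (l, j) else g (l, j))) =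
        (\<Sum>l<n. w l * g (l, j))" if "j \<in> ?J" for j w g
        using that by (intro sum.cong) auto
      then have eq: "(\<forall>j\<in>?J. (\<Sum>l<n. w l * (if (l, j) \<in> {..<n} \<times> {i} then f (l, j) else g (l, j))) = 0) \<longleftrightarrow>
        (\<forall>j\<in>?J. (\<Sum>l<n. w l * g (l, j)) = 0)" for w g
        by (intro ball_cong refl arg_cong[where f = "\<lambda>r. r = 0"])
      have "{g. (\<lambda>x. if x \<in> {..<n} \<times> {i} then f x else g x) \<in> L i} =
        {x. \<exists>w. supp_below n w \<noteq> {} \<and> card (supp_below n w) \<le> s \<and> (\<forall>j\<in>?J. (\<Sum>l<n. w l * x (l, j)) = 0)}"
        unfolding L_def sparse_def mem_Collect_eq eq conj_assoc ..
      moreover have "measure_pmf.prob (Pi_pmf ({..<n} \<times> ?J) d p) \<dots> \<le>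
         real (n choose s) * 2 ^ s * (1 - \<rho> / 2) ^ card ?J"
        using p s i by (intro sparse_kernel_le \<rho>) auto
      ultimately show "measure_pmf.prob (Pi_pmf ({..<n} \<times> ?J) d p)
         {g. (\<lambda>x. if x \<in> {..<n} \<times> {i} then f x else g x) \<in> L i} \<le> \<beta>"
        using i by (simp add: \<beta>_def)
    qed auto
    then have "?P (L i) \<le> \<beta>" unfolding eqs .
    moreover have "measure_pmf.prob (Pi_pmf ({..<n} \<times> ?J \<union> {..<n} \<times> {i}) d p) (F i) \<le>
      (1 + 1 / \<rho>) / sqrt (real (Suc s))"
    proof (rule prob_Pi_pmf_union_le)
      fix f :: "nat \<times> nat \<Rightarrow> real"
      let ?m = "\<lambda>g x. if x \<in> {..<n} \<times> ?J then f x else g x"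
      obtain w where w: "supp_below n w \<noteq> {}" "\<forall>j\<in>?J. (\<Sum>l<n. w l * f (l, j)) = 0"
        using exists_normal_to_other_columns[OF i, of f] by blast
      have J: "(\<Sum>l<n. w l * ?m g (l, j)) = 0" if "j \<in> ?J" for j g
      proof -
        have "(\<Sum>l<n. w l * ?m g (l, j)) = (\<Sum>l<n. w l * f (l, j))"
          using that by (intro sum.cong) auto
        then show ?thesis using w(2) that by simp
      qed
      have col: "(\<Sum>l<n. w l * ?m g (l, i)) = (\<Sum>l<n. w l * g (l, i))" for g
        by (intro sum.cong) auto
      show "measure_pmf.prob (Pi_pmf ({..<n} \<times> {i}) d p) {g. ?m g \<in> F i} \<le>
        (1 + 1 / \<rho>) / sqrt (real (Suc s))"
      proof (cases "sparse w")
        case True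
        then have "?m g \<in> L i" for g
          unfolding L_def mem_Collect_eq by (intro exI[of _ w] conjI ballI J)
        then have "{g. ?m g \<in> F i} = {}" by (auto simp: F_def)
        then show ?thesis using \<rho> by simp
      next
        case False
        \<comment> \<open>A normal that is not sparse has at least \<open>s + 1\<close> nonzero
          coordinates, which makes the Littlewood--Offord bound effective.\<close>
        then have card: "Suc s \<le> card (supp_below n w)" using w by (simp add: sparse_def)
        have "(\<Sum>l<n. w l * g (l, i)) = 0" if "?m g \<in> F i" for g
        proof -
          have "(\<Sum>l<n. w l * ?m g (l, i)) = 0"
            using that J[of _ g] unfolding F_def mem_Collect_eq by blast
          then show ?thesis unfolding col .
        qed
        then have "measure_pmf.prob (Pi_pmf ({..<n} \<times> {i}) d p) {g. ?m g \<in> F i} \<le>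
          measure_pmf.prob (Pi_pmf ({..<n} \<times> {i}) d p) {x. (\<Sum>l<n. w l * x (l, i)) = 0}"
          by (intro measure_pmf.finite_measure_mono) auto
        also have "\<dots> \<le> survival \<rho> (card (supp_below n w)) 1"
          using p i by (intro column_orthogonal_le \<rho>) auto
        also have "\<dots> \<le> (1 + 1 / \<rho>) / sqrt (real (card (supp_below n w)))"
          using card by (intro survival_1_le_sqrt \<rho>) auto
        also have "\<dots> \<le> (1 + 1 / \<rho>) / sqrt (real (Suc s))"
          using card \<rho> by (intro divide_left_mono) auto
        finally show ?thesis .
      qed
    qed auto
    then have "?P (F i) \<le> (1 + 1 / \<rho>) / sqrt (real (Suc s))" unfolding eqs .
    ultimately show ?thesis
      using measure_Un_le[of "L i" "measure_pmf (Pi_pmf ?I d p)" "F i"] by simp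
  qed
  have "{x. det (Matrix.mat n n x) = 0} \<subseteq> R \<union> {x. Suc s \<le> card {i\<in>{..<n}. x \<in> L i \<union> F i}}"
  proof (intro subsetI UnCI)
    fix x :: "nat \<times> nat \<Rightarrow> real"
    assume "x \<in> {x. det (Matrix.mat n n x) = 0}" and xR: "x \<notin> {x. Suc s \<le> card {i\<in>{..<n}. x \<in> L i \<union> F i}}"
    then obtain v where v: "supp_below n v \<noteq> {}" "\<forall>i<n. (\<Sum>j<n. x (i, j) * v j) = 0"
      by (auto simp: det_zero_iff_kernel)
    have "supp_below n v \<subseteq> {i\<in>{..<n}. x \<in> L i \<union> F i}"
    proof
      fix i assume i: "i \<in> supp_below n v"
      have "(\<Sum>l<n. w l * x (l, i)) = 0" if "\<forall>j\<in>{..<n} - {i}. (\<Sum>l<n. w l * x (l, j)) = 0" for w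
        using kernel_support_column_in_span[OF v(2) i that] .
      then show "i \<in> {i\<in>{..<n}. x \<in> L i \<union> F i}"
        using i by (auto simp: F_def supp_below_def)
    qed
    then have "card (supp_below n v) \<le> card {i\<in>{..<n}. x \<in> L i \<union> F i}"
      by (intro card_mono) auto
    then have "sparse v" using v xR by (auto simp: sparse_def)
    then show "x \<in> R" using v(2) by (auto simp: R_def mult.commute)
  qed
  then have "?P {x. det (Matrix.mat n n x) = 0} \<le>
    ?P (R \<union> {x. Suc s \<le> card {i\<in>{..<n}. x \<in> L i \<union> F i}})"
    by (intro measure_pmf.finite_measure_mono) auto
  also have "\<dots> \<le> ?P R + ?P {x. Suc s \<le> card {i\<in>{..<n}. x \<in> L i \<union> F i}}"
    by (intro measure_Un_le) auto
  also have "\<dots> \<le> \<beta> + (\<Sum>i<n. ?P (L i \<union> F i)) / real (Suc s)"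
    by (intro add_mono R prob_at_least_le) auto
  also have "\<dots> \<le> \<beta> + (\<Sum>i<n. \<beta> + (1 + 1 / \<rho>) / sqrt (real (Suc s))) / real (Suc s)"
    by (intro add_left_mono divide_right_mono sum_mono LF) auto
  finally show ?thesis by simp
qed

lemma sparse_weight_bound:
  obtains c D where "0 < c" "c < 1" "0 < D"
    "\<And>n s. n \<ge> 1 \<Longrightarrow> real s \<le> c * real n \<Longrightarrow>
       real (n choose s) * 2 ^ s * (1 - \<rho> / 2) ^ (n - 1) \<le> D / sqrt (real n)"
proof -
  \<comment> \<open>With \<open>\<eta>\<close> the power \<open>-1/4\<close> of
    \<open>\<kappa>\<close>, two factors \<open>\<eta> ^ n\<close> still leave decay, as
    \<open>\<mu>\<close> is the square root of \<open>\<kappa>\<close>. One factor is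
    \<open>(1 + 2 * t) ^ n\<close>, by the choice of \<open>t\<close>; the other absorbs
    \<open>(1 / t) ^ s\<close> when \<open>s \<le> c * n\<close>, by the choice of \<open>c\<close>,
    and the minimum with \<open>1 / 2\<close> keeps \<open>c < 1\<close>.\<close>
  define \<kappa> where "\<kappa> = 1 - \<rho> / 2"
  define \<eta> where "\<eta> = exp (- ln \<kappa> / 4)"
  define t where "t = (\<eta> - 1) / 2"
  define c where "c = min (1 / 2) (ln \<eta> / (1 + \<bar>ln t\<bar>))"
  define \<mu> where "\<mu> = \<eta>\<^sup>2 * \<kappa>"
  have \<kappa>: "0 < \<kappa>" "\<kappa> < 1" using \<rho> by (auto simp: \<kappa>_def)
  have \<eta>: "\<eta> > 1"
    using \<kappa> by (simp add: \<eta>_def)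
  then have t: "t > 0" by (simp add: t_def)
  have c: "0 < c" "c < 1" using \<eta> by (auto simp: c_def)
  have "\<mu> = exp (2 * (- ln \<kappa> / 4) + ln \<kappa>)"
    unfolding exp_add exp_double using \<kappa> by (simp add: \<mu>_def \<eta>_def)
  then have \<mu>: "0 < \<mu>" "\<mu> < 1" using \<kappa> by auto
  have "(\<lambda>n. of_nat n * \<mu> ^ n) \<longlonglongrightarrow> 0"
    using \<mu> by (intro powser_times_n_limit_0) auto
  then have "Bseq (\<lambda>n. of_nat n * \<mu> ^ n)"
    by (intro convergent_imp_Bseq) (rule convergentI)
  then obtain D where D: "D > 0" "\<forall>n. norm (of_nat n * \<mu> ^ n) \<le> D"
    by (rule BseqE)
  show thesis
  proof (rule that[of c "D / \<kappa>"])
    fix n s :: nat assume n: "n \<ge> 1" and s: "real s \<le> c * real n"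
    have "(1 / t) ^ s = exp (- ln t * real s)"
      using t by (simp only: exp_of_nat2_mult exp_minus exp_ln inverse_eq_divide)
    also have "\<dots> \<le> exp (ln \<eta> * real n)"
    proof -
      have "- ln t * real s \<le> (1 + \<bar>ln t\<bar>) * real s" by (intro mult_right_mono) auto
      also have "\<dots> \<le> (1 + \<bar>ln t\<bar>) * (ln \<eta> / (1 + \<bar>ln t\<bar>) * real n)"
      proof (intro mult_left_mono order_trans[OF s] mult_right_mono)
        show "c \<le> ln \<eta> / (1 + \<bar>ln t\<bar>)" by (simp add: c_def)
      qed auto
      also have "\<dots> = ln \<eta> * real n" by (simp add: field_simps add_nonneg_eq_0_iff)
      finally show ?thesis by simp
    qed
    also have "\<dots> = \<eta> ^ n" using \<eta> by (simp add: exp_of_nat2_mult)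
    finally have ts: "(1 / t) ^ s \<le> \<eta> ^ n" .
    have "real (n choose s) * 2 ^ s * \<kappa> ^ (n - 1) \<le> (1 + 2 * t) ^ n * (1 / t) ^ s * \<kappa> ^ (n - 1)"
      using t \<kappa> by (intro mult_right_mono binomial_weight_le) auto
    also have "\<dots> \<le> \<eta> ^ n * \<eta> ^ n * \<kappa> ^ (n - 1)"
    proof -
      have "1 + 2 * t = \<eta>" by (simp add: t_def field_simps)
      then show ?thesis using ts \<eta> \<kappa> by (intro mult_right_mono mult_mono) auto
    qed
    \<comment> \<open>The exponent \<open>n - 1\<close> instead of \<open>n\<close> costs the factor
      \<open>1 / \<kappa>\<close>.\<close>
    also have "\<dots> = \<mu> ^ n / \<kappa>"
      using n \<kappa> by (cases n) (auto simp: \<mu>_def power_mult_distrib power2_eq_square)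
    also have "\<dots> \<le> (D / real n) / \<kappa>"
      using D(2)[rule_format, of n] n \<mu> \<kappa> by (intro divide_right_mono) (auto simp: field_simps)
    also have "\<dots> \<le> (D / sqrt (real n)) / \<kappa>"
    proof -
      have "sqrt (real n) \<le> real n"
        using n by (intro real_le_lsqrt) (auto simp: power2_eq_square)
      then show ?thesis using n D(1) \<kappa> by (intro divide_right_mono divide_left_mono) auto
    qed
    finally show "real (n choose s) * 2 ^ s * (1 - \<rho> / 2) ^ (n - 1) \<le> D / \<kappa> / sqrt (real n)"
      by (simp add: \<kappa>_def mult.commute)
  qed (use c D \<kappa> in auto)
qed

lemma spread_pmf_singular_bound:
  obtains C where "0 < C"
    "\<And>n p d. n \<ge> 1 \<Longrightarrow> (\<And>i j. i < n \<Longrightarrow> j < n \<Longrightarrow> spread_pmf \<rho> (p (i, j))) \<Longrightarrow>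
       measure_pmf.prob (Pi_pmf ({..<n} \<times> {..<n}) d p) {x. det (Matrix.mat n n x) = 0} \<le> C / sqrt (real n)"
proof -
  obtain c D where c: "0 < c" "c < 1" and D: "0 < D" and
    \<beta>: "\<And>n s. n \<ge> 1 \<Longrightarrow> real s \<le> c * real n \<Longrightarrow>
       real (n choose s) * 2 ^ s * (1 - \<rho> / 2) ^ (n - 1) \<le> D / sqrt (real n)"
    using sparse_weight_bound by metis
  define K where "K = 1 + 1 / \<rho>"
  have K: "K > 0" using \<rho> by (simp add: K_def add_pos_pos)
  show thesis
  proof (rule that[of "D + (D + K / sqrt c) / c"])
    show "0 < D + (D + K / sqrt c) / c" using c D K by (intro add_pos_pos divide_pos_pos) auto
    fix n :: nat and p :: "nat \<times> nat \<Rightarrow> real pmf" and d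
    assume n: "n \<ge> 1" and p: "\<And>i j. i < n \<Longrightarrow> j < n \<Longrightarrow> spread_pmf \<rho> (p (i, j))"
    \<comment> \<open>Rounding down keeps \<open>s\<close> within reach of the entropy bound, while
      \<open>s + 1\<close> is at least \<open>c * n\<close>, so the Markov factor
      \<open>n / (s + 1)\<close> is at most \<open>1 / c\<close>.\<close>
    define s where "s = nat \<lfloor>c * real n\<rfloor>"
    define \<beta>' where "\<beta>' = real (n choose s) * 2 ^ s * (1 - \<rho> / 2) ^ (n - 1)"
    have cn: "0 < c * real n" using c n by simp
    have s: "real s \<le> c * real n" "c * real n \<le> real (Suc s)"
      using cn unfolding s_def by linarith+
    have "c * real n \<le> 1 * real n" using c by (intro mult_right_mono) auto
    then have sn: "s \<le> n" using s(1) by simp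
    have \<beta>': "0 \<le> \<beta>'" "\<beta>' \<le> D / sqrt (real n)"
      using \<beta>[OF n s(1)] \<rho> by (auto simp: \<beta>'_def)
    have "measure_pmf.prob (Pi_pmf ({..<n} \<times> {..<n}) d p) {x. det (Matrix.mat n n x) = 0} \<le>
       \<beta>' + real n * (\<beta>' + K / sqrt (real (Suc s))) / real (Suc s)"
      unfolding \<beta>'_def K_def using p sn by (intro singular_prob_le)
    also have "\<dots> \<le> D / sqrt (real n) + real n * (D / sqrt (real n) + K / sqrt (c * real n)) / (c * real n)"
      using s(2) cn \<beta>' K D
      by (intro add_mono frac_le mult_left_mono divide_left_mono mult_nonneg_nonneg add_nonneg_nonneg) auto
    also have "\<dots> = (D + (D + K / sqrt c) / c) / sqrt (real n)"
      using n c by (simp add: real_sqrt_mult field_simps)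
    finally show "measure_pmf.prob (Pi_pmf ({..<n} \<times> {..<n}) d p) {x. det (Matrix.mat n n x) = 0} \<le>
      (D + (D + K / sqrt c) / c) / sqrt (real n)" .
  qed
qed

end

section \<open>Reduction to three-point entries\<close>

lemma spread_pmf_exists:
  assumes "0 < \<rho>" "\<rho> < 1 / 2" "u \<noteq> v"
  shows "\<exists>p. spread_pmf \<rho> p \<and>
    (\<forall>f :: real \<Rightarrow> real. measure_pmf.expectation p f = \<rho> * f u + \<rho> * f v + (1 - 2 * \<rho>) * f w)"
proof -
  \<comment> \<open>A toss of weight \<open>2 * \<rho>\<close> decides between the pair
    \<open>u\<close>, \<open>v\<close> and the point \<open>w\<close>; a fair toss then splits the
    pair.\<close>
  define p where "p = bernoulli_pmf (2 * \<rho>) \<bind>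
    (\<lambda>b. if b then map_pmf (\<lambda>c. if c then u else v) (bernoulli_pmf (1 / 2)) else return_pmf w)"
  have "measure_pmf.expectation p f = \<rho> * f u + \<rho> * f v + (1 - 2 * \<rho>) * f w" for f :: "real \<Rightarrow> real"
    unfolding p_def using assms
    by (subst pmf_expectation_bind[where A = UNIV]) (auto simp: UNIV_bool algebra_simps)
  then show ?thesis using assms(3) unfolding spread_pmf_def by blast
qed

text \<open>Somewhere on \<open>A\<close> the function reaches its mean \<open>b\<close> over
  \<open>A\<close>. Otherwise \<open>b - g\<close> would be positive on \<open>A\<close> with
  integral zero there, forcing \<open>A\<close> to be null.\<close>

lemma (in prob_space) set_integral_le_value:
  fixes g :: "'a \<Rightarrow> real"
  assumes [measurable]: "A \<in> sets M" "g \<in> borel_measurable M"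
    and g: "\<And>x. \<bar>g x\<bar> \<le> 1" and A: "0 < prob A"
  shows "\<exists>v\<in>A. (\<integral>x. indicator A x * g x \<partial>M) \<le> prob A * g v"
proof (rule ccontr)
  assume neg: "\<not> ?thesis"
  define b where "b = (\<integral>x. indicator A x * g x \<partial>M) / prob A"
  have lt: "g v < b" if "v \<in> A" for v
    using neg that A by (auto simp: b_def field_simps not_le)
  have int: "integrable M (\<lambda>x. indicator A x * g x)"
    using g by (intro integrable_const_bound[where B = 1]) (auto simp: indicator_def)
  have int': "integrable M (\<lambda>x. b * indicator A x)"
    by (intro integrable_mult_right integrable_const_bound[where B = 1]) auto
  have eq: "indicator A x * (b - g x) = b * indicator A x - indicator A x * g x" for x
    by (simp add: algebra_simps)
  have "(\<integral>x. indicator A x * (b - g x) \<partial>M) = 0"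
    unfolding eq using int int' A by (subst Bochner_Integration.integral_diff) (auto simp: b_def)
  moreover have "integrable M (\<lambda>x. indicator A x * (b - g x))"
    unfolding eq using int int' by (rule Bochner_Integration.integrable_diff[rotated])
  moreover have "AE x in M. 0 \<le> indicator A x * (b - g x)"
    using lt by (intro AE_I2) (auto simp: indicator_def less_imp_le)
  ultimately have "AE x in M. indicator A x * (b - g x) = 0"
    using integral_nonneg_eq_0_iff_AE by blast
  then have "AE x in M. x \<notin> A"
    by eventually_elim (use lt in \<open>fastforce simp: indicator_def split: if_splits\<close>)
  then have "prob A = 0"
    by (simp add: AE_iff_measurable[OF _ refl] prob_eq_0)
  with A show False by simp
qed

text \<open>On each tail and on the middle part, \<open>g\<close> is replaced by a value no smaller
  than its mean there. Each tail keeps mass \<open>\<rho>\<close> at its point; all remaining mass,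
  \<open>1 - 2 * \<rho>\<close> in total, moves to the best of the three points. The tail points
  differ since \<open>xm < xp\<close> separates them.\<close>

lemma expectation_le_spread_pmf:
  fixes g :: "real \<Rightarrow> real"
  assumes "prob_space M" and M: "sets M = sets borel" and g [measurable]: "g \<in> borel_measurable borel"
    and g01: "\<And>x. 0 \<le> g x \<and> g x \<le> 1" and \<rho>: "0 < \<rho>" "\<rho> < 1 / 2"
    and x: "xm < xp" "measure M {x. xp < x} > \<rho>" "measure M {x. x < xm} > \<rho>"
  shows "\<exists>p. spread_pmf \<rho> p \<and> (\<integral>x. g x \<partial>M) \<le> measure_pmf.expectation p g"
proof -
  interpret prob_space M by fact
  have [measurable_cong]: "sets M = sets borel" by (rule M)
  have sp: "space M = UNIV" using sets_eq_imp_space_eq[OF M] by simp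
  have meas: "g \<in> borel_measurable M" by measurable
  have gabs: "\<And>x. \<bar>g x\<bar> \<le> 1" using g01 by auto
  let ?A = "{x. xp < x}" and ?B = "{x. x < xm}"
  let ?R = "- (?A \<union> ?B)"
  let ?int = "\<lambda>S. \<integral>x. indicator S x * g x \<partial>M"
  have sets: "?A \<in> sets M" "?B \<in> sets M" "?R \<in> sets M" by (auto simp: M)
  have int: "integrable M (\<lambda>x. indicator S x * g x)" if "S \<in> sets M" for S
    using that meas gabs by (intro integrable_const_bound[where B = 1]) (auto simp: indicator_def)
  obtain u where u: "u < xm" "?int ?B \<le> prob ?B * g u"
    using set_integral_le_value[OF sets(2) meas gabs] x \<rho> by auto
  obtain v where v: "xp < v" "?int ?A \<le> prob ?A * g v"
    using set_integral_le_value[OF sets(1) meas gabs] x \<rho> by auto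
  have "\<exists>w. ?int ?R \<le> prob ?R * g w"
  proof (cases "prob ?R = 0")
    \<comment> \<open>A null middle part has no mean to compare with, but both sides are then
      bounded through zero mass and any \<open>w\<close> will do.\<close>
    case True
    have "?int ?R \<le> (\<integral>x. indicator ?R x \<partial>M)"
      using int[OF sets(3)] sets(3) g01
      by (intro integral_mono) (auto simp: indicator_def intro!: integrable_const_bound[where B = 1])
    also have "\<dots> = 0" using True sets(3) sp by simp
    finally show ?thesis using True by auto
  next
    case False
    then have "0 < prob ?R" by (simp add: zero_less_measure_iff)
    from set_integral_le_value[OF sets(3) meas gabs this] show ?thesis by blast
  qed
  then obtain w where w: "?int ?R \<le> prob ?R * g w" ..
  define m where "m = max (g u) (max (g v) (g w))"
  obtain y where y: "g y = m" unfolding m_def max_def by metis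
  have total: "prob ?A + prob ?B + prob ?R = 1"
  proof -
    have "prob (?A \<union> ?B) = prob ?A + prob ?B"
      using sets x(1) by (intro finite_measure_Union) auto
    moreover have "prob ?R = 1 - prob (?A \<union> ?B)"
      using prob_compl[of "?A \<union> ?B"] sets sp by (simp add: Compl_eq_Diff_UNIV)
    ultimately show ?thesis by simp
  qed
  have "g z = (indicator ?A z * g z + indicator ?B z * g z) + indicator ?R z * g z" for z
    using x(1) by (auto simp: indicator_def)
  then have "expectation g = (\<integral>z. (indicator ?A z * g z + indicator ?B z * g z) + indicator ?R z * g z \<partial>M)"
    by simp
  also have "\<dots> = ?int ?A + ?int ?B + ?int ?R"
    using int sets by (simp add: Bochner_Integration.integral_add)
  also have "\<dots> \<le> prob ?A * g v + prob ?B * g u + prob ?R * g w"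
    using u v w by simp
  also have "\<dots> = \<rho> * g v + \<rho> * g u + ((prob ?A - \<rho>) * g v + (prob ?B - \<rho>) * g u + prob ?R * g w)"
    by (simp add: algebra_simps)
  also have "\<dots> \<le> \<rho> * g v + \<rho> * g u + ((prob ?A - \<rho>) * m + (prob ?B - \<rho>) * m + prob ?R * m)"
    using x by (intro add_mono mult_left_mono order_refl) (auto simp: m_def)
  also have "\<dots> = \<rho> * g v + \<rho> * g u + (prob ?A + prob ?B + prob ?R - 2 * \<rho>) * m"
    by (simp add: algebra_simps)
  also have "\<dots> = \<rho> * g u + \<rho> * g v + (1 - 2 * \<rho>) * g y"
    unfolding total y by simp
  finally show ?thesis
    using spread_pmf_exists[OF \<rho>, of u v y] u v x(1) by force
qed

section \<open>Replacing the entry laws one at a time\<close>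

lemma expectation_Pi_pmf_insert:
  fixes g :: "('i \<Rightarrow> 'a) \<Rightarrow> real"
  assumes "finite I" "i \<notin> I" "\<And>x. \<bar>g x\<bar> \<le> b"
  shows "measure_pmf.expectation (Pi_pmf (insert i I) d q) g =
    measure_pmf.expectation (Pi_pmf I d q) (\<lambda>x. measure_pmf.expectation (q i) (\<lambda>y. g (x(i := y))))"
proof -
  have "Pi_pmf (insert i I) d q = bind_pmf (Pi_pmf I d q) (\<lambda>x. map_pmf (\<lambda>y. x(i := y)) (q i))"
    unfolding Pi_pmf_insert'[OF assms(1,2)] by (subst bind_commute_pmf) (simp add: map_pmf_def)
  then show ?thesis using assms(3) by (simp add: expectation_bind_pmf[where b = b])
qed

text \<open>By Fubini the integral is that of a function \<open>G\<close> of coordinate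
  \<open>i\<close> alone, so the one-variable comparison yields a law \<open>p\<close> for it.
  Averaging \<open>g\<close> over \<open>p\<close> in that coordinate gives \<open>g'\<close>, to
  which the induction hypothesis applies.\<close>

lemma product_expectation_le_spread_pmf:
  fixes N :: "'i \<Rightarrow> real measure" and g :: "('i \<Rightarrow> real) \<Rightarrow> real"
  assumes \<rho>: "0 < \<rho>" "\<rho> < 1 / 2"
    and prob: "\<And>i. prob_space (N i)" and sets: "\<And>i. sets (N i) = sets borel"
    and "finite I"
    and "\<And>i. i \<in> I \<Longrightarrow> \<exists>xm xp. xm < xp \<and> measure (N i) {x. xp < x} > \<rho> \<and> measure (N i) {x. x < xm} > \<rho>"
    and "g \<in> borel_measurable (Pi\<^sub>M I N)" and "\<And>x. 0 \<le> g x \<and> g x \<le> 1"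
  shows "\<exists>q. (\<forall>i\<in>I. spread_pmf \<rho> (q i)) \<and>
    (\<integral>x. g x \<partial>Pi\<^sub>M I N) \<le> measure_pmf.expectation (Pi_pmf I undefined q) g"
  using assms(5-)
proof (induction I arbitrary: g rule: finite_induct)
  case empty
  show ?case by (simp add: PiM_empty lebesgue_integral_count_space_finite)
next
  case (insert i I)
  interpret N: prob_space "N k" for k by (rule prob)
  interpret P: product_prob_space N by unfold_locales
  interpret PI: prob_space "Pi\<^sub>M I N" by (rule prob_space_PiM) (rule prob)
  interpret pair: pair_prob_space "Pi\<^sub>M I N" "N i" by unfold_locales
  interpret PiI: prob_space "Pi\<^sub>M (insert i I) N" by (rule prob_space_PiM) (rule prob)
  note g = insert(5)[measurable] and g01 = insert(6)
  have upd [measurable]: "(\<lambda>(x, y). g (x(i := y))) \<in> borel_measurable (Pi\<^sub>M I N \<Otimes>\<^sub>M N i)"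
    using measurable_comp[OF measurable_add_dim[of i I N] g] by (simp add: comp_def case_prod_unfold)
  have int: "integrable (Pi\<^sub>M I N \<Otimes>\<^sub>M N i) (\<lambda>(x, y). g (x(i := y)))"
    using g01 by (intro pair.integrable_const_bound[where B = 1]) (auto simp: case_prod_unfold)
  define G where "G y = (\<integral>x. g (x(i := y)) \<partial>Pi\<^sub>M I N)" for y
  have "integrable (Pi\<^sub>M (insert i I) N) g"
    using g01 by (intro PiI.integrable_const_bound[where B = 1]) auto
  then have "(\<integral>x. g x \<partial>Pi\<^sub>M (insert i I) N) = (\<integral>x. (\<integral>y. g (x(i := y)) \<partial>N i) \<partial>Pi\<^sub>M I N)"
    using insert by (intro P.product_integral_insert)
  also have "\<dots> = (\<integral>y. G y \<partial>N i)"
    unfolding G_def using pair.Fubini_integral[OF int] by simp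
  finally have fub: "(\<integral>x. g x \<partial>Pi\<^sub>M (insert i I) N) = (\<integral>y. G y \<partial>N i)" .
  have upd1: "(\<lambda>x. g (x(i := y))) \<in> borel_measurable (Pi\<^sub>M I N)" for y
  proof -
    have "y \<in> space (N i)" using sets_eq_imp_space_eq[OF sets] by simp
    then show ?thesis using measurable_compose[OF measurable_Pair2' upd] by simp
  qed
  have int1: "integrable (Pi\<^sub>M I N) (\<lambda>x. g (x(i := y)))" for y
    using g01 upd1 by (intro PI.integrable_const_bound[where B = 1]) auto
  have G01: "0 \<le> G y \<and> G y \<le> 1" for y
    unfolding G_def using g01 int1 by (auto intro!: integral_nonneg PI.integral_le_const)
  have "G \<in> borel_measurable (N i)"
    unfolding G_def using upd by (intro PI.borel_measurable_lebesgue_integral) (simp add: measurable_split_conv)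
  then have Gm: "G \<in> borel_measurable borel"
    using measurable_cong_sets[OF sets refl] by metis
  obtain xm xp where "xm < xp" "measure (N i) {x. xp < x} > \<rho>" "measure (N i) {x. x < xm} > \<rho>"
    using insert(4)[of i] by auto
  then obtain p where p: "spread_pmf \<rho> p" "(\<integral>y. G y \<partial>N i) \<le> measure_pmf.expectation p G"
    using expectation_le_spread_pmf[OF prob sets Gm G01 \<rho>] by metis
  obtain u v w where E:
    "\<And>f :: real \<Rightarrow> real. measure_pmf.expectation p f = \<rho> * f u + \<rho> * f v + (1 - 2 * \<rho>) * f w"
    using p(1) unfolding spread_pmf_def by auto
  define g' where "g' x = measure_pmf.expectation p (\<lambda>y. g (x(i := y)))" for x
  have g'E: "g' x = \<rho> * g (x(i := u)) + \<rho> * g (x(i := v)) + (1 - 2 * \<rho>) * g (x(i := w))" for x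
    unfolding g'_def by (rule E)
  \<comment> \<open>Measurability is immediate because \<open>p\<close> turns \<open>g'\<close> into
    a sum of three sections of \<open>g\<close>.\<close>
  have g'm: "g' \<in> borel_measurable (Pi\<^sub>M I N)"
    unfolding g'E[abs_def] using upd1 by (intro borel_measurable_add borel_measurable_times) auto
  have g'01: "0 \<le> g' x \<and> g' x \<le> 1" for x
    unfolding g'_def using g01
    by (auto intro!: integral_nonneg measure_pmf.integral_le_const measure_pmf.integrable_const_bound[where B = 1])
  obtain q where q: "\<forall>i\<in>I. spread_pmf \<rho> (q i)"
    "(\<integral>x. g' x \<partial>Pi\<^sub>M I N) \<le> measure_pmf.expectation (Pi_pmf I undefined q) g'"
    using insert.IH[OF _ g'm g'01] insert(4) by auto
  have "(\<integral>x. g' x \<partial>Pi\<^sub>M I N) = measure_pmf.expectation p G"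
    unfolding E g'E[abs_def] G_def using int1 by simp
  then have le: "(\<integral>x. g x \<partial>Pi\<^sub>M (insert i I) N) \<le> measure_pmf.expectation (Pi_pmf I undefined q) g'"
    using fub p q by simp
  \<comment> \<open>As \<open>i\<close> lies outside \<open>I\<close>, the law found for it can be
    added to \<open>q\<close> without changing the product over \<open>I\<close>.\<close>
  have "Pi_pmf I undefined q = Pi_pmf I undefined (q(i := p))"
    using insert by (intro Pi_pmf_cong) auto
  then have "measure_pmf.expectation (Pi_pmf I undefined q) g' =
    measure_pmf.expectation (Pi_pmf (insert i I) undefined (q(i := p))) g"
    using insert g01 by (subst expectation_Pi_pmf_insert[where b = 1]) (auto simp: g'_def[abs_def])
  then have "(\<integral>x. g x \<partial>Pi\<^sub>M (insert i I) N) \<le>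
      measure_pmf.expectation (Pi_pmf (insert i I) undefined (q(i := p))) g"
    using le by (simp only:)
  moreover have "\<forall>j\<in>insert i I. spread_pmf \<rho> ((q(i := p)) j)" using p q by auto
  ultimately show ?case by blast
qed

lemma det_measurable:
  "(\<lambda>x. det (Matrix.mat n n x :: real mat)) \<in> borel_measurable (Pi\<^sub>M ({..<n} \<times> {..<n}) (\<lambda>_. borel))"
proof -
  have "det (Matrix.mat n n x) = (\<Sum>\<pi>\<in>{\<pi>. \<pi> permutes {0..<n}}. signof \<pi> * (\<Prod>i = 0..<n. x (i, \<pi> i)))"
    for x :: "nat \<times> nat \<Rightarrow> real"
    by (subst det_def'[of _ n]) (auto intro!: sum.cong prod.cong dest: permutes_in_image)
  then have "(\<lambda>x. det (Matrix.mat n n x :: real mat)) =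
     (\<lambda>x. \<Sum>\<pi>\<in>{\<pi>. \<pi> permutes {0..<n}}. signof \<pi> * (\<Prod>i = 0..<n. x (i, \<pi> i)))" by auto
  also have "\<dots> \<in> borel_measurable (Pi\<^sub>M ({..<n} \<times> {..<n}) (\<lambda>_. borel))"
    by (intro borel_measurable_sum borel_measurable_times borel_measurable_const borel_measurable_prod
        measurable_component_singleton) (auto dest: permutes_in_image)
  finally show ?thesis .
qed

section \<open>General entries\<close>

lemma singular_random_matrix_iff:
  "singular_mat (random_matrix n a \<omega>) \<longleftrightarrow> det (Matrix.mat n n (\<lambda>ij\<in>{..<n} \<times> {..<n}. a ij \<omega>)) = 0"
proof -
  have "random_matrix n a \<omega> = Matrix.mat n n (\<lambda>ij\<in>{..<n} \<times> {..<n}. a ij \<omega>)"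
    unfolding random_matrix_def by (intro eq_matI) auto
  then show ?thesis using singular_mat_iff_det[of "random_matrix n a \<omega>" n] by simp
qed

lemma (in prob_space) singular_prob_eq_distr:
  fixes n :: nat
  defines "I \<equiv> {..<n} \<times> {..<n}"
  assumes rv: "\<And>i. i \<in> I \<Longrightarrow> random_variable borel (a i)"
  shows "\<P>(\<omega> in M. singular_mat (random_matrix n a \<omega>)) =
    measure (distr M (\<Pi>\<^sub>M i\<in>I. borel) (\<lambda>\<omega>. \<lambda>i\<in>I. a i \<omega>))
      {x \<in> space (\<Pi>\<^sub>M i\<in>I. borel). det (Matrix.mat n n x :: real mat) = 0}"
proof -
  have [measurable]: "(\<lambda>\<omega>. \<lambda>i\<in>I. a i \<omega>) \<in> measurable M (\<Pi>\<^sub>M i\<in>I. borel)"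
    using rv by (intro measurable_restrict)
  note det_measurable[of n, folded I_def, measurable]
  have "{x \<in> space (\<Pi>\<^sub>M i\<in>I. borel). det (Matrix.mat n n x :: real mat) = 0} \<in> sets (\<Pi>\<^sub>M i\<in>I. borel)"
    by measurable
  then show ?thesis
    by (subst measure_distr)
       (auto simp: singular_random_matrix_iff I_def[symmetric] space_PiM intro!: arg_cong[where f = prob])
qed

text \<open>Repackages the hypothesis in terms of laws: the joint law is the product of the
  marginals. \<open>n \<ge> 1\<close> supplies the nonempty index set on which this characterisation
  of independence is applied.\<close>

lemma independent_spread_entriesE:
  assumes "independent_spread_entries \<rho> n M a" "prob_space M" "n \<ge> 1"
  obtains "\<And>i. i \<in> {..<n} \<times> {..<n} \<Longrightarrow> a i \<in> borel_measurable M"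
    and "distr M (\<Pi>\<^sub>M i\<in>{..<n} \<times> {..<n}. borel) (\<lambda>\<omega>. \<lambda>i\<in>{..<n} \<times> {..<n}. a i \<omega>) =
         (\<Pi>\<^sub>M i\<in>{..<n} \<times> {..<n}. distr M borel (a i))"
    and "\<And>i. i \<in> {..<n} \<times> {..<n} \<Longrightarrow> \<exists>xm xp. xm < xp \<and>
      measure (distr M borel (a i)) {x. xp < x} > \<rho> \<and> measure (distr M borel (a i)) {x. x < xm} > \<rho>"
proof -
  interpret prob_space M by fact
  let ?I = "{..<n} \<times> {..<n}"
  have indep: "indep_vars (\<lambda>_. borel) a ?I" and
    spread: "\<forall>i<n. \<forall>j<n. \<exists>xm xp. xm < xp \<and>
        \<P>(\<omega> in M. a (i, j) \<omega> > xp) > \<rho> \<and> \<P>(\<omega> in M. a (i, j) \<omega> < xm) > \<rho>"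
    using assms(1) by (auto simp: independent_spread_entries_def)
  have rv: "a i \<in> borel_measurable M" if "i \<in> ?I" for i
    using indep that by (auto simp: indep_vars_def)
  have "?I \<noteq> {}" using assms(3) by (auto simp: lessThan_empty_iff)
  then have eq: "distr M (\<Pi>\<^sub>M i\<in>?I. borel) (\<lambda>\<omega>. \<lambda>i\<in>?I. a i \<omega>) = (\<Pi>\<^sub>M i\<in>?I. distr M borel (a i))"
    using indep rv by (subst indep_vars_iff_distr_eq_PiM'[symmetric]) auto
  have "\<exists>xm xp. xm < xp \<and>
      measure (distr M borel (a i)) {x. xp < x} > \<rho> \<and> measure (distr M borel (a i)) {x. x < xm} > \<rho>"
    if "i \<in> ?I" for i
  proof -
    have "measure (distr M borel (a i)) {x. xp < x} = \<P>(\<omega> in M. a i \<omega> > xp)"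
      "measure (distr M borel (a i)) {x. x < xp} = \<P>(\<omega> in M. a i \<omega> < xp)" for xp
      using rv[OF that] by (auto simp: measure_distr intro!: arg_cong[where f = prob])
    then show ?thesis using spread that by auto
  qed
  with rv eq show thesis by (rule that)
qed

lemma singularity_bound_exists:
  assumes \<rho>: "0 < \<rho>" "\<rho> < 1 / 2"
  shows "\<exists>C>0. singularity_bound TYPE('w) \<rho> C"
proof -
  obtain C where C: "0 < C" and bound:
    "\<And>n p d. n \<ge> 1 \<Longrightarrow> (\<And>i j. i < n \<Longrightarrow> j < n \<Longrightarrow> spread_pmf \<rho> (p (i, j))) \<Longrightarrow>
       measure_pmf.prob (Pi_pmf ({..<n} \<times> {..<n}) d p) {x. det (Matrix.mat n n x) = 0} \<le> C / sqrt (real n)"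
    using spread_pmf_singular_bound[OF \<rho>] by metis
  have "\<P>(\<omega> in M. singular_mat (random_matrix n a \<omega>)) \<le> C / sqrt (real n)"
    if n: "n \<ge> 1" and M: "prob_space M" and a: "independent_spread_entries \<rho> n M a"
    for n and M :: "'w measure" and a
  proof -
    interpret prob_space M by fact
    define I where "I = {..<n} \<times> {..<n}"
    \<comment> \<open>The point mass at \<open>0\<close> is a filler outside \<open>I\<close>, so
      that every \<open>N i\<close> is a probability measure on the Borel sets.\<close>
    define N where "N i = (if i \<in> I then distr M borel (a i) else return borel 0)" for i
    define g :: "(nat \<times> nat \<Rightarrow> real) \<Rightarrow> real" where "g = indicator {x. det (Matrix.mat n n x) = 0}"
    from a M n obtain rv: "\<And>i. i \<in> I \<Longrightarrow> a i \<in> borel_measurable M"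
      and distr: "distr M (\<Pi>\<^sub>M i\<in>I. borel) (\<lambda>\<omega>. \<lambda>i\<in>I. a i \<omega>) = (\<Pi>\<^sub>M i\<in>I. distr M borel (a i))"
      and spread: "\<And>i. i \<in> I \<Longrightarrow> \<exists>xm xp. xm < xp \<and>
      measure (distr M borel (a i)) {x. xp < x} > \<rho> \<and> measure (distr M borel (a i)) {x. x < xm} > \<rho>"
      unfolding I_def by (rule independent_spread_entriesE) blast
    have prob: "prob_space (N i)" for i
      using prob_space_distr[OF rv] by (simp add: N_def prob_space_return)
    have sets: "sets (N i) = sets borel" for i by (simp add: N_def)
    have PiN: "(\<Pi>\<^sub>M i\<in>I. distr M borel (a i)) = Pi\<^sub>M I N"
      by (rule PiM_cong) (auto simp: N_def)
    have setsPi: "sets (Pi\<^sub>M I N) = sets (\<Pi>\<^sub>M i\<in>I. borel)"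
      by (intro sets_PiM_cong sets refl)
    note det_measurable[of n, folded I_def, measurable]
    have S: "{x \<in> space (\<Pi>\<^sub>M i\<in>I. borel). det (Matrix.mat n n x :: real mat) = 0} \<in> sets (\<Pi>\<^sub>M i\<in>I. borel)"
      by measurable
    then have g: "g \<in> borel_measurable (Pi\<^sub>M I N)"
      unfolding g_def measurable_cong_sets[OF setsPi refl]
      by (intro borel_measurable_indicator') (simp add: Int_def conj_commute)
    have "\<exists>q. (\<forall>i\<in>I. spread_pmf \<rho> (q i)) \<and>
      (\<integral>x. g x \<partial>Pi\<^sub>M I N) \<le> measure_pmf.expectation (Pi_pmf I undefined q) g"
    proof (rule product_expectation_le_spread_pmf)
      show "finite I" by (simp add: I_def)
      show "\<exists>xm xp. xm < xp \<and> measure (N i) {x. xp < x} > \<rho> \<and> measure (N i) {x. x < xm} > \<rho>" if "i \<in> I" for i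
        using spread[OF that] that by (simp add: N_def)
      show "0 \<le> g x \<and> g x \<le> 1" for x by (simp add: g_def indicator_def)
    qed fact+
    then obtain q where q: "\<forall>i\<in>I. spread_pmf \<rho> (q i)"
      "(\<integral>x. g x \<partial>Pi\<^sub>M I N) \<le> measure_pmf.expectation (Pi_pmf I undefined q) g"
      by blast
    have "\<P>(\<omega> in M. singular_mat (random_matrix n a \<omega>)) =
      measure (Pi\<^sub>M I N) {x \<in> space (\<Pi>\<^sub>M i\<in>I. borel). det (Matrix.mat n n x :: real mat) = 0}"
      using singular_prob_eq_distr[of n a, folded I_def, OF rv] distr PiN by simp
    also have "\<dots> = (\<integral>x. indicator {x \<in> space (\<Pi>\<^sub>M i\<in>I. borel). det (Matrix.mat n n x :: real mat) = 0} x \<partial>Pi\<^sub>M I N)"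
      using S setsPi by simp
    also have "\<dots> = (\<integral>x. g x \<partial>Pi\<^sub>M I N)"
      using sets_eq_imp_space_eq[OF setsPi]
      by (intro Bochner_Integration.integral_cong refl) (auto simp: g_def indicator_def)
    also have "\<dots> \<le> measure_pmf.prob (Pi_pmf I undefined q) {x. det (Matrix.mat n n x) = 0}"
      using q(2) by (simp add: g_def)
    also have "\<dots> \<le> C / sqrt (real n)"
      unfolding I_def using q(1) n by (intro bound) (auto simp: I_def)
    finally show ?thesis .
  qed
  then show ?thesis using C unfolding singularity_bound_def by blast
qed

text \<open>Hypothesis and conclusion depend only on the joint law of the entries. That law lives on
  \<open>nat \<times> nat \<Rightarrow> real\<close>, where the coordinate functions realise it, so
  the constant for this one sample space applies.\<close>

lemma singularity_bound_transfer:
  assumes C: "singularity_bound TYPE(nat \<times> nat \<Rightarrow> real) \<rho> C"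
  shows "singularity_bound TYPE('w) \<rho> C"
  unfolding singularity_bound_def
proof (intro allI impI)
  fix n :: nat and M :: "'w measure" and a
  assume n: "1 \<le> n" and M: "prob_space M" and a: "independent_spread_entries \<rho> n M a"
  interpret prob_space M by fact
  define I where "I = {..<n} \<times> {..<n}"
  define \<X> where "\<X> = (\<lambda>\<omega>. \<lambda>i\<in>I. a i \<omega>)"
  define N where "N = distr M (\<Pi>\<^sub>M i\<in>I. borel) \<X>"
  define b where "b = (\<lambda>i (x :: nat \<times> nat \<Rightarrow> real). x i)"
  from a M n obtain rv: "\<And>i. i \<in> I \<Longrightarrow> a i \<in> borel_measurable M"
    and distr: "distr M (\<Pi>\<^sub>M i\<in>I. borel) (\<lambda>\<omega>. \<lambda>i\<in>I. a i \<omega>) = (\<Pi>\<^sub>M i\<in>I. distr M borel (a i))"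
    and spread: "\<And>i. i \<in> I \<Longrightarrow> \<exists>xm xp. xm < xp \<and>
      measure (distr M borel (a i)) {x. xp < x} > \<rho> \<and> measure (distr M borel (a i)) {x. x < xm} > \<rho>"
    unfolding I_def by (rule independent_spread_entriesE) blast
  have X: "\<X> \<in> measurable M (\<Pi>\<^sub>M i\<in>I. borel)"
    unfolding \<X>_def using rv by (intro measurable_restrict)
  interpret N: prob_space N unfolding N_def by (rule prob_space_distr[OF X])
  have bm: "b i \<in> borel_measurable (\<Pi>\<^sub>M i\<in>I. borel)" if "i \<in> I" for i
    using that by (simp add: b_def measurable_component_singleton)
  then have bN: "b i \<in> borel_measurable N" if "i \<in> I" for i
    using that by (simp add: N_def)
  have law: "distr N borel (b i) = distr M borel (a i)" if "i \<in> I" for i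
    unfolding N_def using that
    by (subst distr_distr[OF bm X]) (auto simp: b_def \<X>_def comp_def intro!: distr_cong)
  have restr: "(\<lambda>x. \<lambda>i\<in>I. b i x) \<in> measurable (\<Pi>\<^sub>M i\<in>I. borel) (\<Pi>\<^sub>M i\<in>I. borel)"
    using bm by (intro measurable_restrict)
  have joint: "distr N (\<Pi>\<^sub>M i\<in>I. borel) (\<lambda>x. \<lambda>i\<in>I. b i x) = distr M (\<Pi>\<^sub>M i\<in>I. borel) \<X>"
    unfolding N_def
    by (subst distr_distr[OF restr X]) (auto simp: b_def \<X>_def comp_def fun_eq_iff intro!: distr_cong)
  have "I \<noteq> {}" using n by (auto simp: I_def lessThan_empty_iff)
  moreover have "distr M (\<Pi>\<^sub>M i\<in>I. borel) \<X> = (\<Pi>\<^sub>M i\<in>I. distr N borel (b i))"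
    using distr law unfolding \<X>_def by (auto intro!: PiM_cong)
  \<comment> \<open>The coordinates have the marginals of \<open>a\<close> and their joint law is
    the product of these, hence they are independent under \<open>N\<close>.\<close>
  ultimately have indep: "N.indep_vars (\<lambda>_. borel) b I"
    using bN joint by (subst N.indep_vars_iff_distr_eq_PiM') auto
  have "independent_spread_entries \<rho> n N b"
    unfolding independent_spread_entries_def
  proof (intro conjI allI impI)
    fix i j assume ij: "i < n" "j < n"
    then have mem: "(i, j) \<in> I" by (simp add: I_def)
    have "measure (distr M borel (a (i, j))) {x. t < x} = \<P>(\<omega> in N. b (i, j) \<omega> > t)"
      "measure (distr M borel (a (i, j))) {x. x < t} = \<P>(\<omega> in N. b (i, j) \<omega> < t)" for t
      unfolding law[OF mem, symmetric] using bN[OF mem]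
      by (auto simp: measure_distr intro!: arg_cong[where f = N.prob])
    then show "\<exists>xm xp. xm < xp \<and> \<P>(\<omega> in N. b (i, j) \<omega> > xp) > \<rho> \<and> \<P>(\<omega> in N. b (i, j) \<omega> < xm) > \<rho>"
      using spread[OF mem] by simp
  qed (use indep in \<open>simp add: I_def\<close>)
  then have "\<P>(x in N. singular_mat (random_matrix n b x)) \<le> C / sqrt (real n)"
    using C n N.prob_space_axioms unfolding singularity_bound_def by blast
  then show "\<P>(\<omega> in M. singular_mat (random_matrix n a \<omega>)) \<le> C / sqrt (real n)"
    using singular_prob_eq_distr[of n a, folded I_def, OF rv]
      N.singular_prob_eq_distr[of n b, folded I_def, OF bN] joint by (simp add: \<X>_def)
qed

(* HOL cannot quantify over sample-space types below the existential quantifier for C, and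
   "EX C. singularity_bound TYPE('w) rho C" alone would let C vary with 'w.  So C is obtained for
   one fixed sample-space type, and every such C is asserted to serve every type 'w as well. *)
theorem proposition1:
  fixes \<rho> :: real
  assumes "0 < \<rho>" and "\<rho> < 1 / 2"
  shows "(\<exists>C>0. singularity_bound TYPE(nat \<times> nat \<Rightarrow> real) \<rho> C) \<and>
         (\<forall>C>0. singularity_bound TYPE(nat \<times> nat \<Rightarrow> real) \<rho> C
                  \<longrightarrow> singularity_bound TYPE('w) \<rho> C)"
  using singularity_bound_exists[OF assms] singularity_bound_transfer by blast

end
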